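(* Let $k=\mathbb{C}$ or $k=\mathbb{R}$, let $R\in k$, $R\neq 0$, and let $A$ be a symmetric special Frobenius algebra over $k$ with Frobenius form $\varepsilon$ whose distinguished element $\beta=m(B)$ satisfies $R\beta=1$. Write $A$, up to isomorphism of algebras, as $A=\bigoplus_{i=1}^N \mathbb{M}_{n_i}(\mathbb{C})$ if $k=\mathbb{C}$, or as $A=\bigoplus_{i=1}^N \mathbb{M}_{n_i}(D_i)$ with each $D_i\in\{\mathbb{R},\mathbb{C}_{\mathbb{R}},\mathbb{H}_{\mathbb{R}}\}$ if $k=\mathbb{R}$. Then the topological invariant $Z(\Sigma_g)$ constructed from $A$ and a closed connected oriented surface $\Sigma_g$ of genus $g$ is $$Z(\Sigma_g)=R^{2-2g}\sum_{i=1}^N n_i^{2-2g}\qquad\text{if } k=\mathbb{C},$$ and $$Z(\Sigma_g)=R^{2-2g}\sum_{i=1}^N f(i,g)\,n_i^{2-2g},\qquad f(i,g)=\begin{cases}1 & (D_i=\mathbb{R})\\ 2 & (D_i=\mathbb{C}_{\mathbb{R}})\\ 2^{2-2g} & (D_i=\mathbb{H}_{\mathbb{R}})\end{cases}\qquad\text{if } k=\mathbb{R}.$$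
   Context: A Frobenius algebra over $k$ is a finite-dimensional associative unital $k$-algebra $A$ with multiplication $m$ and a linear map $\varepsilon\colon A\to k$ (the Frobenius form) such that the bilinear form $B^{-1}=\varepsilon\circ m$ on $A$, $B^{-1}(x,y)=\varepsilon(x\cdot y)$, is non-degenerate. It is symmetric if $\varepsilon\circ m$ is symmetric. With a basis $(e_a)_{a\in S}$ of $A$ and $B_{ab}=\varepsilon(e_a\cdot e_b)$, let $B^{ab}$ be the inverse matrix, $B_{ac}B^{cb}=\delta_a^b$ (repeated indices are summed), and $B=B^{ab}\,e_a\otimes e_b\in A\otimes A$; $B$ does not depend on the basis. The distinguished element is $\beta=m(B)=B^{ab}\,e_a\cdot e_b$. The Frobenius algebra is special if $\beta$ is a non-zero multiple of $1$. $\mathbb{C}_{\mathbb{R}}$ and $\mathbb{H}_{\mathbb{R}}$ denote the complex numbers and quaternions regarded as algebras over $\mathbb{R}$; $\mathbb{M}_n(D)$ is the algebra of $n\times n$ matrices over $D$. The state sum: put $C_{abc}=\varepsilon(e_a\cdot e_b\cdot e_c)$. Given a triangulation of the closed oriented surface $\Sigma_g$ with $V$ vertices (degenerate triangulations, in which two simplexes may intersect in more than one face, are allowed), assign to each edge of each triangle a variable in $S$. A triangle whose edges carry states $a,b,c$, in the cyclic order given by the orientation, has amplitude $C_{abc}$; an edge, at which two triangles meet with the edge carrying the state $a$ in one triangle and $b$ in the other, has amplitude $B^{ab}$. Then $$Z(\Sigma_g)=R^V\sum_{\text{states}}\ \prod_{\text{triangles }t}(\text{amplitude of }t)\prod_{\text{edges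 }e}(\text{amplitude of }e).$$ This number is independent of the triangulation chosen. *)

theory Defs
  imports "HOL-Analysis.Analysis" "Jordan_Normal_Form.Matrix"
begin

section \<open>Frobenius algebras\<close>

text \<open>
  The algebra is a whole type. The sort \<open>{ring, monoid_mult}\<close> (rather than \<open>ring_1\<close>) admits the
  zero algebra, which is the empty direct sum. A basis is a set \<open>S\<close> of vectors indexed by itself,
  \<open>e\<^sub>a = a\<close>.
\<close>

locale fin_dim_algebra = finite_dimensional_vector_space smul S
  for smul :: "'k::field \<Rightarrow> 'a::{ring,monoid_mult} \<Rightarrow> 'a" and S :: "'a set" +
  assumes smul_mult_left: "smul r x * y = smul r (x * y)"
    and smul_mult_right: "x * smul r y = smul r (x * y)"

text \<open>
  \<open>form_inverse S \<epsilon> a b\<close> is \<open>B\<^sup>a\<^sup>b\<close>. For a non-degenerate form its values on \<open>S \<times> S\<close> are uniquely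
  determined; no other values are ever used.
\<close>

definition form_inverse :: "'a set \<Rightarrow> ('a::times \<Rightarrow> 'k::field) \<Rightarrow> 'a \<Rightarrow> 'a \<Rightarrow> 'k" where
  "form_inverse S \<epsilon> =
     (SOME X. \<forall>a\<in>S. \<forall>b\<in>S. (\<Sum>c\<in>S. \<epsilon> (a * c) * X c b) = (if a = b then 1 else 0))"

definition distinguished_element ::
  "('k::field \<Rightarrow> 'a::{ring,monoid_mult} \<Rightarrow> 'a) \<Rightarrow> 'a set \<Rightarrow> ('a \<Rightarrow> 'k) \<Rightarrow> 'a" where
  "distinguished_element smul S \<epsilon> = (\<Sum>a\<in>S. \<Sum>b\<in>S. smul (form_inverse S \<epsilon> a b) (a * b))"

locale frobenius_algebra = fin_dim_algebra smul S
  for smul :: "'k::field \<Rightarrow> 'a::{ring,monoid_mult} \<Rightarrow> 'a" and S :: "'a set" +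
  fixes \<epsilon> :: "'a \<Rightarrow> 'k"
  assumes linear_form: "Vector_Spaces.linear smul (*) \<epsilon>"
    and nondegenerate_left: "(\<forall>y. \<epsilon> (x * y) = 0) \<Longrightarrow> x = 0"
    and nondegenerate_right: "(\<forall>x. \<epsilon> (x * y) = 0) \<Longrightarrow> y = 0"

locale symmetric_special_frobenius_algebra = frobenius_algebra +
  assumes symmetric: "\<epsilon> (x * y) = \<epsilon> (y * x)"
    and special: "\<exists>c. c \<noteq> 0 \<and> distinguished_element smul S \<epsilon> = smul c 1"

section \<open>Quaternions\<close>

datatype quat = Quat (q_re: real) (q_i: real) (q_j: real) (q_k: real)

instantiation quat :: real_algebra_1
begin

definition "0 = Quat 0 0 0 0"
definition "1 = Quat 1 0 0 0"
definition "p + q = Quat (q_re p + q_re q) (q_i p + q_i q) (q_j p + q_j q) (q_k p + q_k q)"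
definition "- p = Quat (- q_re p) (- q_i p) (- q_j p) (- q_k p)"
definition "p - q = Quat (q_re p - q_re q) (q_i p - q_i q) (q_j p - q_j q) (q_k p - q_k q)"
definition "p * q = Quat
  (q_re p * q_re q - q_i p * q_i q - q_j p * q_j q - q_k p * q_k q)
  (q_re p * q_i q + q_i p * q_re q + q_j p * q_k q - q_k p * q_j q)
  (q_re p * q_j q - q_i p * q_k q + q_j p * q_re q + q_k p * q_i q)
  (q_re p * q_k q + q_i p * q_j q - q_j p * q_i q + q_k p * q_re q)"
definition "r *\<^sub>R p = Quat (r * q_re p) (r * q_i p) (r * q_j p) (r * q_k p)"

instance
  by standard
    (auto simp: zero_quat_def one_quat_def plus_quat_def uminus_quat_def minus_quat_def
      times_quat_def scaleR_quat_def quat.expand algebra_simps)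

end

section \<open>Direct sums of matrix algebras\<close>

text \<open>
  An algebra on an explicit carrier is a \<open>module\<close> record, that is a ring record together with a
  scalar multiplication. The first argument of \<open>mat_algebra\<close> is the action of the ground field on
  matrix entries.
\<close>

definition mat_algebra :: "('k \<Rightarrow> 'd::semiring_1 \<Rightarrow> 'd) \<Rightarrow> nat \<Rightarrow> ('k, 'd mat) module" where
  "mat_algebra s n =
     \<lparr>carrier = carrier_mat n n, mult = (*), one = 1\<^sub>m n, zero = 0\<^sub>m n n, add = (+),
      smult = (\<lambda>r. map_mat (s r))\<rparr>"

definition direct_sum_algebra ::
  "'i set \<Rightarrow> ('i \<Rightarrow> ('k, 'b) module) \<Rightarrow> ('k, 'i \<Rightarrow> 'b) module" where
  "direct_sum_algebra I M =
     \<lparr>carrier = (\<Pi>\<^sub>E i\<in>I. carrier (M i)),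
      mult = (\<lambda>x y. \<lambda>i\<in>I. mult (M i) (x i) (y i)),
      one = (\<lambda>i\<in>I. one (M i)),
      zero = (\<lambda>i\<in>I. zero (M i)),
      add = (\<lambda>x y. \<lambda>i\<in>I. add (M i) (x i) (y i)),
      smult = (\<lambda>r x. \<lambda>i\<in>I. smult (M i) r (x i))\<rparr>"

definition algebra_isomorphic ::
  "('k \<Rightarrow> 'a::{ring,monoid_mult} \<Rightarrow> 'a) \<Rightarrow> ('k, 'b) module \<Rightarrow> bool" where
  "algebra_isomorphic smul M \<longleftrightarrow>
     (\<exists>\<phi>. bij_betw \<phi> UNIV (carrier M) \<and>
       (\<forall>x y. \<phi> (x + y) = add M (\<phi> x) (\<phi> y)) \<and>
       (\<forall>x y. \<phi> (x * y) = mult M (\<phi> x) (\<phi> y)) \<and>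
       \<phi> 1 = one M \<and>
       (\<forall>r x. \<phi> (smul r x) = smult M r (\<phi> x)))"

text \<open>
  Over the reals the summands have entries in different types. A tag embeds the three kinds of
  matrices into one type, and \<open>transport_algebra\<close> carries an algebra along such a tag.
\<close>

datatype real_division_algebra = Real_DA | Complex_DA | Quaternion_DA

datatype tagged_mat =
    Real_Mat (the_real_mat: "real mat")
  | Complex_Mat (the_complex_mat: "complex mat")
  | Quaternion_Mat (the_quaternion_mat: "quat mat")

definition transport_algebra ::
  "('b \<Rightarrow> 'c) \<Rightarrow> ('c \<Rightarrow> 'b) \<Rightarrow> ('k, 'b) module \<Rightarrow> ('k, 'c) module" where
  "transport_algebra tag untag M =
     \<lparr>carrier = tag ` carrier M,
      mult = (\<lambda>x y. tag (mult M (untag x) (untag y))),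
      one = tag (one M),
      zero = tag (zero M),
      add = (\<lambda>x y. tag (add M (untag x) (untag y))),
      smult = (\<lambda>r x. tag (smult M r (untag x)))\<rparr>"

fun real_block :: "real_division_algebra \<Rightarrow> nat \<Rightarrow> (real, tagged_mat) module" where
  "real_block Real_DA n = transport_algebra Real_Mat the_real_mat (mat_algebra scaleR n)"
| "real_block Complex_DA n = transport_algebra Complex_Mat the_complex_mat (mat_algebra scaleR n)"
| "real_block Quaternion_DA n =
     transport_algebra Quaternion_Mat the_quaternion_mat (mat_algebra scaleR n)"

section \<open>Triangulated oriented surfaces\<close>

text \<open>
  A possibly degenerate triangulation of a closed oriented surface is a finite set of oriented
  triangles whose edges are glued in pairs by orientation-reversing identifications. The pair
  \<open>(t, j)\<close> with \<open>j < 3\<close> is the \<open>j\<close>-th edge of triangle \<open>t\<close> in the cyclic order given by the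
  orientation; it runs from corner \<open>j\<close> to corner \<open>j + 1\<close> (modulo 3) of \<open>t\<close>. An edge of the
  surface is a pair of glued triangle edges.
\<close>

record 't triangulation =
  triangles :: "'t set"
  glue :: "'t \<times> nat \<Rightarrow> 't \<times> nat"

definition triangle_edges :: "'t triangulation \<Rightarrow> ('t \<times> nat) set" where
  "triangle_edges T = triangles T \<times> {..<3}"

definition next_edge :: "'t \<times> nat \<Rightarrow> 't \<times> nat" where
  "next_edge d = (fst d, (snd d + 1) mod 3)"

definition surface_edges :: "'t triangulation \<Rightarrow> ('t \<times> nat) set set" where
  "surface_edges T = (\<lambda>d. {d, glue T d}) ` triangle_edges T"

text \<open>
  Corner \<open>j\<close> of \<open>t\<close> is also denoted \<open>(t, j)\<close>. Gluing \<open>(t, j)\<close> to \<open>(t', j')\<close> with reversed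
  direction identifies the initial corner \<open>(t, j)\<close> of the first edge with the final corner
  \<open>next_edge (t', j')\<close> of the second, and vice versa.
\<close>

definition surface_vertices :: "'t triangulation \<Rightarrow> ('t \<times> nat) set set" where
  "surface_vertices T = triangle_edges T //
     {(c, c'). c \<in> triangle_edges T \<and>
        equivclp (\<lambda>d d'. d \<in> triangle_edges T \<and> d' = next_edge (glue T d)) c c'}"

definition closed_surface_triangulation :: "'t triangulation \<Rightarrow> bool" where
  "closed_surface_triangulation T \<longleftrightarrow>
     finite (triangles T) \<and>
     (\<forall>d\<in>triangle_edges T.
        glue T d \<in> triangle_edges T \<and> glue T d \<noteq> d \<and> glue T (glue T d) = d)"

definition connected_triangulation :: "'t triangulation \<Rightarrow> bool" where
  "connected_triangulation T \<longleftrightarrow>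
     triangles T \<noteq> {} \<and>
     (\<forall>d\<in>triangle_edges T. \<forall>d'\<in>triangle_edges T.
        equivclp (\<lambda>x y. x \<in> triangle_edges T \<and> (y = next_edge x \<or> y = glue T x)) d d')"

definition euler_characteristic :: "'t triangulation \<Rightarrow> int" where
  "euler_characteristic T =
     int (card (surface_vertices T)) - int (card (surface_edges T)) + int (card (triangles T))"

text \<open>
  \<open>T\<close> triangulates the closed connected oriented surface of genus \<open>g\<close>. As usual for combinatorial
  surfaces, the genus is read off from Euler's formula \<open>V - E + F = 2 - 2g\<close>.
\<close>

definition triangulates_genus :: "'t triangulation \<Rightarrow> nat \<Rightarrow> bool" where
  "triangulates_genus T g \<longleftrightarrow>
     closed_surface_triangulation T \<and> connected_triangulation T \<and>
     euler_characteristic T = 2 - 2 * int g"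

section \<open>The state sum\<close>

definition triangle_amplitude ::
  "('a::times \<Rightarrow> 'k::field) \<Rightarrow> ('t \<times> nat \<Rightarrow> 'a) \<Rightarrow> 't \<Rightarrow> 'k" where
  "triangle_amplitude \<epsilon> s t = \<epsilon> (s (t, 0) * s (t, 1) * s (t, 2))"

text \<open>
  For a symmetric form \<open>form_inverse S \<epsilon>\<close> is symmetric on \<open>S\<close>, so the amplitude does not depend on
  which of the two sides \<open>d\<close> of the edge is selected.
\<close>

definition edge_amplitude ::
  "'a set \<Rightarrow> ('a::times \<Rightarrow> 'k::field) \<Rightarrow> 't triangulation \<Rightarrow>
     ('t \<times> nat \<Rightarrow> 'a) \<Rightarrow> ('t \<times> nat) set \<Rightarrow> 'k" where
  "edge_amplitude S \<epsilon> T s e = (let d = (SOME d. d \<in> e) in form_inverse S \<epsilon> (s d) (s (glue T d)))"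

definition state_sum ::
  "'k::field \<Rightarrow> 'a set \<Rightarrow> ('a::times \<Rightarrow> 'k) \<Rightarrow> 't triangulation \<Rightarrow> 'k" where
  "state_sum R S \<epsilon> T =
     R ^ card (surface_vertices T) *
     (\<Sum>s \<in> triangle_edges T \<rightarrow>\<^sub>E S.
        (\<Prod>t\<in>triangles T. triangle_amplitude \<epsilon> s t) *
        (\<Prod>e\<in>surface_edges T. edge_amplitude S \<epsilon> T s e))"

definition surface_weight :: "real_division_algebra \<Rightarrow> nat \<Rightarrow> real" where
  "surface_weight D g =
     (case D of Real_DA \<Rightarrow> 1 | Complex_DA \<Rightarrow> 2 | Quaternion_DA \<Rightarrow> 2 powi (2 - 2 * int g))"

end

theory Submission
  imports Defs
begin

text \<open>
  Extend scalars to \<open>\<complex>\<close>, where the algebra becomes a direct sum of matrix algebras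
  \<open>\<bbbM>\<^bsub>m\<^sub>j\<^esub>(\<complex>)\<close>: a real block over \<open>\<complex>\<close> splits into
  two conjugate blocks of the same size, and a real block over the quaternions becomes one block of
  twice the size. The tensor \<open>B\<close> is invariant under the algebra, so on each block it is a multiple of
  the flip of matrix units; the condition \<open>R \<beta> = 1\<close> forces the multiple to be \<open>1 / (R m\<^sub>j)\<close>, and
  dually \<open>\<epsilon>\<close> is the sum of the traces weighted by \<open>R m\<^sub>j\<close>. Expanding the traces over matrix
  indices puts an index on every corner of every triangle, and the edge amplitudes force these
  indices to agree around each vertex. A block therefore contributes
  \<open>R\<^sup>V (R m\<^sub>j)\<^bsup>F-E\<^esup> m\<^sub>j\<^sup>V = (R m\<^sub>j)\<^bsup>2-2g\<^esup>\<close>.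
\<close>

section \<open>Dual bases\<close>

text \<open>The tensor product of the algebra with \<complex> is never built. The blocks are kept as
  matrix-valued maps \<open>\<psi> j\<close> on the algebra itself, and identities in the extended
  algebra appear as identities between matrix entries, contracted over the basis \<open>S\<close> of
  the original algebra. Two facts that scalar extension would supply must therefore be stated by
  hand: each matrix unit is a combination \<open>u * x + v * y\<close> of images with coefficients
  in the larger field (two images suffice for all the algebras at hand), and the regular trace takes
  values in the ground field. The second lets values of the trace form serve as scalars in the
  algebra, which is how that form is compared with \<open>\<epsilon>\<close>. The constant: the flip
  is the sum of E_pq \<otimes> E_qp over all p, q, and multiplying its two factors gives m_j times
  the identity. If B is c times the flip on the block, then R c m_j = 1. The factors f(i,g) come
  from the same count: two blocks of size n for \<complex>, and one block of size 2n for the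
  quaternions, whence (2n)^(2-2g).\<close>

context frobenius_algebra
begin

lemma form_add: "\<epsilon> (x + y) = \<epsilon> x + \<epsilon> y"
  using linear_form by (simp add: Vector_Spaces.linear_iff)

lemma form_scale: "\<epsilon> (smul r x) = r * \<epsilon> x"
  using linear_form by (simp add: Vector_Spaces.linear_iff)

lemma form_zero [simp]: "\<epsilon> 0 = 0"
  using form_scale[of 0 0] by simp

lemma form_diff: "\<epsilon> (x - y) = \<epsilon> x - \<epsilon> y"
  using form_add[of "x - y" y] by simp

lemma form_sum: "\<epsilon> (sum f I) = (\<Sum>i\<in>I. \<epsilon> (f i))"
  by (induction I rule: infinite_finite_induct) (simp_all add: form_add)

text \<open>The map \<open>f\<close> with coordinates \<open>\<epsilon> (a * y)\<close> is the
  identification of the algebra with its dual, written as an endomorphism. Non-degeneracy makes it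
  injective, finite dimension makes it surjective, and a preimage of \<open>b\<close> is the vector
  sought.\<close>

lemma ex_dual_vector:
  assumes "b \<in> S"
  shows "\<exists>y. \<forall>a\<in>S. \<epsilon> (a * y) = (if a = b then 1 else 0)"
proof -
  define f where "f = (\<lambda>y. \<Sum>a\<in>S. smul (\<epsilon> (a * y)) a)"
  have lin: "Vector_Spaces.linear smul smul f"
    by (auto simp: f_def Vector_Spaces.linear_iff vector_space_axioms form_add form_scale
        distrib_left scale_left_distrib sum.distrib smul_mult_right scale_sum_right)
  have coeff: "c = d"
    if "(\<Sum>a\<in>S. smul (g a) a) = (\<Sum>a\<in>S. smul (h a) a)" "a \<in> S" "c = g a" "d = h a"
    for g h a c d
  proof -
    have "(\<Sum>a\<in>S. smul (g a - h a) a) = 0"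
      using that(1) by (simp add: scale_left_diff_distrib sum_subtractf)
    from independentD[OF independent_Basis finite_Basis order_refl this that(2)]
    show ?thesis using that(3,4) by simp
  qed
  have "inj f"
  proof (rule injI)
    fix y z assume "f y = f z"
    then have eq: "\<epsilon> (a * (y - z)) = 0" if "a \<in> S" for a
      using coeff[of "\<lambda>a. \<epsilon> (a * y)" "\<lambda>a. \<epsilon> (a * z)" a] that
      by (simp add: f_def right_diff_distrib form_diff)
    have "\<epsilon> (x * (y - z)) = 0" for x
    proof -
      have "x \<in> span S" by (simp add: span_Basis)
      then show ?thesis
        by (induction rule: span_induct_alt)
          (simp_all only: distrib_right form_add smul_mult_left form_scale eq mult_zero_left mult_zero_right form_zero add_0)
    qed
    then show "y = z" using nondegenerate_right[of "y - z"] by simp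
  qed
  from linear_inj_imp_surj[OF lin this] obtain y where "f y = b"
    by (metis surjD)
  moreover have "b = (\<Sum>a\<in>S. smul (if a = b then 1 else 0) a)"
    using assms finite_Basis by (simp add: if_distrib[where f = "\<lambda>r. smul r _"] cong: if_cong)
  ultimately show ?thesis
    using coeff[of "\<lambda>a. \<epsilon> (a * y)" "\<lambda>a. if a = b then 1 else 0", OF _ _ refl refl]
    by (intro exI[of _ y]) (simp add: f_def)
qed

text \<open>The choice operator in the definition is meaningful only once some inverse matrix
  exists; its columns are the coordinates of the dual vectors just found.\<close>

lemma form_inverse:
  assumes "a \<in> S" "b \<in> S"
  shows "(\<Sum>c\<in>S. \<epsilon> (a * c) * form_inverse S \<epsilon> c b) = (if a = b then 1 else 0)"
proof -
  obtain y where y: "\<And>a b. a \<in> S \<Longrightarrow> b \<in> S \<Longrightarrow> \<epsilon> (a * y b) = (if a = b then 1 else 0)"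
    using ex_dual_vector by metis
  have "\<exists>X. \<forall>a\<in>S. \<forall>b\<in>S. (\<Sum>c\<in>S. \<epsilon> (a * c) * X c b) = (if a = b then 1 else 0)"
  proof (intro exI ballI)
    fix a b assume "a \<in> S" "b \<in> S"
    have "(\<Sum>c\<in>S. smul (representation S (y b) c) c) = y b"
      using independent_Basis finite_Basis by (simp add: sum_representation_eq span_Basis)
    then have "\<epsilon> (a * y b) = \<epsilon> (a * (\<Sum>c\<in>S. smul (representation S (y b) c) c))"
      by simp
    then show "(\<Sum>c\<in>S. \<epsilon> (a * c) * representation S (y b) c) = (if a = b then 1 else 0)"
      using y[OF \<open>a \<in> S\<close> \<open>b \<in> S\<close>]
      by (simp add: sum_distrib_left smul_mult_right form_sum form_scale mult.commute)
  qed
  from someI_ex[OF this] show ?thesis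
    using assms by (auto simp: form_inverse_def)
qed

text \<open>The basis dual to \<open>S\<close> under the form. It turns B into a single sum: B is
  the sum of \<open>dual_vector b\<close> \<otimes> \<open>b\<close>, and for a symmetric form also
  of \<open>a\<close> \<otimes> \<open>dual_vector a\<close>.\<close>

definition dual_vector :: "'a \<Rightarrow> 'a" where
  "dual_vector b = (\<Sum>c\<in>S. smul (form_inverse S \<epsilon> c b) c)"

lemma form_dual_vector:
  assumes "a \<in> S" "b \<in> S"
  shows "\<epsilon> (a * dual_vector b) = (if a = b then 1 else 0)"
  using form_inverse[OF assms]
  by (simp add: dual_vector_def sum_distrib_left smul_mult_right form_sum form_scale mult.commute)

text \<open>The difference \<open>?z\<close> of the two sides is orthogonal to each basis vector,
  hence to the whole algebra, and non-degeneracy makes it zero.\<close>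

lemma dual_vector_expansion: "(\<Sum>a\<in>S. smul (\<epsilon> (a * x)) (dual_vector a)) = x"
proof -
  let ?z = "(\<Sum>a\<in>S. smul (\<epsilon> (a * x)) (dual_vector a)) - x"
  have eq: "\<epsilon> (b * ?z) = 0" if "b \<in> S" for b
  proof -
    have "\<epsilon> (b * (\<Sum>a\<in>S. smul (\<epsilon> (a * x)) (dual_vector a))) = (\<Sum>a\<in>S. \<epsilon> (a * x) * \<epsilon> (b * dual_vector a))"
      by (simp add: sum_distrib_left smul_mult_right form_sum form_scale)
    also have "\<dots> = (\<Sum>a\<in>S. if b = a then \<epsilon> (a * x) else 0)"
      by (rule sum.cong) (simp_all add: form_dual_vector that)
    also have "\<dots> = \<epsilon> (b * x)"
      using that finite_Basis by simp
    finally show ?thesis by (simp add: right_diff_distrib form_diff)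
  qed
  have "\<epsilon> (w * ?z) = 0" for w
  proof -
    have "w \<in> span S" by (simp add: span_Basis)
    then show ?thesis
    proof (induction rule: span_induct_alt)
      case (step c v w)
      then show ?case
        by (simp only: distrib_right form_add smul_mult_left form_scale eq mult_zero_right add_0)
    qed simp
  qed
  then show ?thesis using nondegenerate_right[of ?z] by simp
qed

end

context symmetric_special_frobenius_algebra
begin

lemma basis_expansion: "(\<Sum>a\<in>S. smul (\<epsilon> (x * dual_vector a)) a) = x"
proof -
  have x: "x = (\<Sum>a\<in>S. smul (representation S x a) a)"
    using independent_Basis finite_Basis by (simp add: sum_representation_eq span_Basis)
  have "\<epsilon> (x * dual_vector b) = representation S x b" if "b \<in> S" for b
  proof -
    have "\<epsilon> (x * dual_vector b) = \<epsilon> ((\<Sum>a\<in>S. smul (representation S x a) a) * dual_vector b)"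
      using x by simp
    also have "\<dots> = (\<Sum>a\<in>S. representation S x a * \<epsilon> (a * dual_vector b))"
      by (simp add: sum_distrib_right smul_mult_left form_sum form_scale)
    also have "\<dots> = (\<Sum>a\<in>S. if a = b then representation S x a else 0)"
      by (rule sum.cong) (simp_all add: form_dual_vector that)
    also have "\<dots> = representation S x b"
      using that finite_Basis by simp
    finally show ?thesis .
  qed
  then show ?thesis using x by simp
qed

text \<open>The inverse matrix is itself a Gram matrix, that of the dual vectors, so it inherits the
  symmetry of the form.\<close>

lemma form_inverse_commute:
  assumes "a \<in> S" "b \<in> S"
  shows "form_inverse S \<epsilon> a b = form_inverse S \<epsilon> b a"
proof -
  have eq: "\<epsilon> (dual_vector a * dual_vector b) = form_inverse S \<epsilon> b a" if "a \<in> S" "b \<in> S" for a b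
  proof -
    have "\<epsilon> (dual_vector a * dual_vector b) =
        (\<Sum>c\<in>S. form_inverse S \<epsilon> c a * \<epsilon> (c * dual_vector b))"
      by (subst (1) dual_vector_def)
        (simp add: sum_distrib_right smul_mult_left form_sum form_scale)
    also have "\<dots> = (\<Sum>c\<in>S. if c = b then form_inverse S \<epsilon> c a else 0)"
      by (rule sum.cong) (simp_all add: form_dual_vector that)
    also have "\<dots> = form_inverse S \<epsilon> b a"
      using that finite_Basis by simp
    finally show ?thesis .
  qed
  show ?thesis using eq[of a b] eq[of b a] assms symmetric by metis
qed

end

section \<open>Splitting of algebras over an extension field\<close>

text \<open>Presents an algebra that fills a type as a record, so that one notion of splitting
  covers it together with algebras on explicit carriers.\<close>

definition ring_algebra :: "('k \<Rightarrow> 'a::{ring,monoid_mult} \<Rightarrow> 'a) \<Rightarrow> ('k, 'a) module" where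
  "ring_algebra s =
     \<lparr>carrier = UNIV, mult = (*), one = 1, zero = 0, add = (+), smult = s\<rparr>"

text \<open>
  A splitting over a field extension \<open>\<iota>\<close> is a family of matrix representations indexed by \<open>J\<close>
  that, after extension of scalars, becomes an isomorphism onto the direct sum of the matrix algebras
  of sizes \<open>m j\<close>. Injectivity after extension of scalars is encoded by injectivity before it
  together with the rationality \<open>entry_trace\<close> of the regular trace.
\<close>

locale matrix_splitting = emb: field_hom \<iota>
  for \<iota> :: "'k::field \<Rightarrow> 'c::field" +
  fixes M :: "('k, 'b) module" and J :: "'j set" and m :: "'j \<Rightarrow> nat"
    and \<psi> :: "'j \<Rightarrow> 'b \<Rightarrow> nat \<Rightarrow> nat \<Rightarrow> 'c"
  assumes finite_index: "finite J"
    and size_pos: "j \<in> J \<Longrightarrow> 0 < m j"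
    and zero_closed: "zero M \<in> carrier M"
    and entry_zero: "j \<in> J \<Longrightarrow> p < m j \<Longrightarrow> q < m j \<Longrightarrow> \<psi> j (zero M) p q = 0"
    and entry_add: "x \<in> carrier M \<Longrightarrow> y \<in> carrier M \<Longrightarrow> j \<in> J \<Longrightarrow> p < m j \<Longrightarrow> q < m j \<Longrightarrow>
      \<psi> j (add M x y) p q = \<psi> j x p q + \<psi> j y p q"
    and entry_scale: "x \<in> carrier M \<Longrightarrow> j \<in> J \<Longrightarrow> p < m j \<Longrightarrow> q < m j \<Longrightarrow>
      \<psi> j (smult M r x) p q = \<iota> r * \<psi> j x p q"
    and entry_mult: "x \<in> carrier M \<Longrightarrow> y \<in> carrier M \<Longrightarrow> j \<in> J \<Longrightarrow> p < m j \<Longrightarrow> q < m j \<Longrightarrow>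
      \<psi> j (mult M x y) p q = (\<Sum>r<m j. \<psi> j x p r * \<psi> j y r q)"
    and entry_one: "j \<in> J \<Longrightarrow> p < m j \<Longrightarrow> q < m j \<Longrightarrow>
      \<psi> j (one M) p q = (if p = q then 1 else 0)"
    and entry_inj: "x \<in> carrier M \<Longrightarrow> y \<in> carrier M \<Longrightarrow>
      (\<And>j p q. j \<in> J \<Longrightarrow> p < m j \<Longrightarrow> q < m j \<Longrightarrow> \<psi> j x p q = \<psi> j y p q) \<Longrightarrow> x = y"
    and entry_unit: "j \<in> J \<Longrightarrow> p < m j \<Longrightarrow> q < m j \<Longrightarrow>
      \<exists>u v. \<exists>x\<in>carrier M. \<exists>y\<in>carrier M. \<forall>l\<in>J. \<forall>r<m l. \<forall>s<m l.
        u * \<psi> l x r s + v * \<psi> l y r s = (if l = j \<and> r = p \<and> s = q then 1 else 0)"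
    and entry_trace: "x \<in> carrier M \<Longrightarrow>
      \<exists>r. (\<Sum>j\<in>J. of_nat (m j) * (\<Sum>p<m j. \<psi> j x p p)) = \<iota> r"

lemma matrix_splitting_transport:
  assumes "matrix_splitting \<iota> M J m \<psi>" and tag: "\<And>x. untag (tag x) = x"
  shows "matrix_splitting \<iota> (transport_algebra tag untag M) J m (\<lambda>j x. \<psi> j (untag x))"
proof -
  interpret matrix_splitting \<iota> M J m \<psi> by fact
  show ?thesis
  proof unfold_locales
    fix j p q assume "j \<in> J" "p < m j" "q < m j"
    from entry_unit[OF this]
    show "\<exists>u v. \<exists>x\<in>carrier (transport_algebra tag untag M). \<exists>y\<in>carrier (transport_algebra tag untag M).
        \<forall>l\<in>J. \<forall>r<m l. \<forall>s<m l. u * \<psi> l (untag x) r s + v * \<psi> l (untag y) r s =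
          (if l = j \<and> r = p \<and> s = q then 1 else 0)"
      by (simp add: transport_algebra_def tag)
  next
    fix x y assume "x \<in> carrier (transport_algebra tag untag M)"
      "y \<in> carrier (transport_algebra tag untag M)"
      and "\<And>j p q. j \<in> J \<Longrightarrow> p < m j \<Longrightarrow> q < m j \<Longrightarrow> \<psi> j (untag x) p q = \<psi> j (untag y) p q"
    then show "x = y"
      using entry_inj[of "untag x" "untag y"] by (auto simp: transport_algebra_def tag)
  qed (auto simp: transport_algebra_def tag finite_index size_pos zero_closed entry_zero entry_add
      entry_scale entry_mult entry_one entry_trace)
qed

lemma matrix_splitting_isomorphic:
  assumes "matrix_splitting \<iota> M J m \<psi>" and "algebra_isomorphic s M"
  shows "\<exists>\<psi>'. matrix_splitting \<iota> (ring_algebra s) J m \<psi>'"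
proof -
  interpret matrix_splitting \<iota> M J m \<psi> by fact
  obtain \<phi> where bij: "bij_betw \<phi> UNIV (carrier M)"
    and hom: "\<And>x y. \<phi> (x + y) = add M (\<phi> x) (\<phi> y)" "\<And>x y. \<phi> (x * y) = mult M (\<phi> x) (\<phi> y)"
      "\<phi> 1 = one M" "\<And>r x. \<phi> (s r x) = smult M r (\<phi> x)"
    using assms(2) unfolding algebra_isomorphic_def by blast
  have carrier: "\<phi> x \<in> carrier M" for x
    using bij by (auto simp: bij_betw_def)
  have "matrix_splitting \<iota> (ring_algebra s) J m (\<lambda>j x. \<psi> j (\<phi> x))"
  proof unfold_locales
    fix j p q assume j: "j \<in> J" "p < m j" "q < m j"
    \<comment> \<open>An algebra isomorphism is not assumed to preserve zero, so the vanishing at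
      \<open>0\<close> is derived from additivity.\<close>
    have "\<psi> j (\<phi> (0 + 0)) p q = \<psi> j (\<phi> 0) p q + \<psi> j (\<phi> 0) p q"
      by (simp only: hom entry_add carrier j)
    then show "\<psi> j (\<phi> (zero (ring_algebra s))) p q = 0"
      by (simp only: ring_algebra_def ring.simps add_0 add_cancel_right_right)
    obtain u v x y where "x \<in> carrier M" "y \<in> carrier M" and
      unit: "\<forall>l\<in>J. \<forall>r<m l. \<forall>s<m l. u * \<psi> l x r s + v * \<psi> l y r s =
          (if l = j \<and> r = p \<and> s = q then 1 else 0)"
      using entry_unit[OF j] by blast
    then obtain x' y' where "x = \<phi> x'" "y = \<phi> y'"
      using bij unfolding bij_betw_def by blast
    with unit show "\<exists>u v. \<exists>x\<in>carrier (ring_algebra s). \<exists>y\<in>carrier (ring_algebra s).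
        \<forall>l\<in>J. \<forall>r<m l. \<forall>s<m l. u * \<psi> l (\<phi> x) r s + v * \<psi> l (\<phi> y) r s =
          (if l = j \<and> r = p \<and> s = q then 1 else 0)"
      by (intro exI[of _ u] exI[of _ v] bexI[of _ x'] bexI[of _ y']) (simp_all add: ring_algebra_def)
  next
    fix x y assume "\<And>j p q. j \<in> J \<Longrightarrow> p < m j \<Longrightarrow> q < m j \<Longrightarrow> \<psi> j (\<phi> x) p q = \<psi> j (\<phi> y) p q"
    then have "\<phi> x = \<phi> y" using entry_inj[OF carrier carrier] by blast
    then show "x = y" using bij by (metis bij_betw_def injD)
  qed (auto simp: ring_algebra_def hom carrier finite_index size_pos entry_add
      entry_scale entry_mult entry_one entry_trace)
  then show ?thesis by blast
qed

lemma matrix_splitting_direct_sum: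
  assumes I: "finite I" and hom: "field_hom \<iota>"
    and split: "\<And>i. i \<in> I \<Longrightarrow> matrix_splitting \<iota> (M i) (K i) (m i) (\<psi> i)"
  shows "matrix_splitting \<iota> (direct_sum_algebra I M) (SIGMA i:I. K i) (\<lambda>(i, j). m i j)
    (\<lambda>(i, j) x. \<psi> i j (x i))"
proof -
  interpret emb: field_hom \<iota> by fact
  note [simp] = direct_sum_algebra_def
  have mem: "x i \<in> carrier (M i)" if "x \<in> (\<Pi>\<^sub>E i\<in>I. carrier (M i))" "i \<in> I" for x i
    using that by (rule PiE_mem)
  show ?thesis
  proof unfold_locales
    show "finite (SIGMA i:I. K i)"
      using I split by (auto intro!: finite_SigmaI dest: matrix_splitting.finite_index)
    show "zero (direct_sum_algebra I M) \<in> carrier (direct_sum_algebra I M)"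
      using split by (auto dest: matrix_splitting.zero_closed)
    fix x y assume "x \<in> carrier (direct_sum_algebra I M)" "y \<in> carrier (direct_sum_algebra I M)"
    then have x: "x \<in> (\<Pi>\<^sub>E i\<in>I. carrier (M i))" and y: "y \<in> (\<Pi>\<^sub>E i\<in>I. carrier (M i))" by simp_all
    assume eq: "\<And>j p q. j \<in> (SIGMA i:I. K i) \<Longrightarrow> p < (case j of (i, j) \<Rightarrow> m i j) \<Longrightarrow>
        q < (case j of (i, j) \<Rightarrow> m i j) \<Longrightarrow>
        (case j of (i, j) \<Rightarrow> \<lambda>x. \<psi> i j (x i)) x p q = (case j of (i, j) \<Rightarrow> \<lambda>x. \<psi> i j (x i)) y p q"
    show "x = y"
    proof (rule PiE_ext[OF x y])
      fix i assume i: "i \<in> I"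
      show "x i = y i"
      proof (rule matrix_splitting.entry_inj[OF split[OF i] PiE_mem[OF x i] PiE_mem[OF y i]])
        fix j p q assume "j \<in> K i" "p < m i j" "q < m i j"
        then show "\<psi> i j (x i) p q = \<psi> i j (y i) p q"
          using eq[of "(i, j)" p q] i by simp
      qed
    qed
  next
    fix ij assume "ij \<in> (SIGMA i:I. K i)"
    then show "0 < (case ij of (i, j) \<Rightarrow> m i j)"
      using split by (auto dest: matrix_splitting.size_pos)
  next
    fix ij p q assume "ij \<in> (SIGMA i:I. K i)" "p < (case ij of (i, j) \<Rightarrow> m i j)"
        "q < (case ij of (i, j) \<Rightarrow> m i j)"
    then obtain i j where ij: "ij = (i, j)" and i: "i \<in> I" and j: "j \<in> K i" "p < m i j" "q < m i j"
      by auto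
    from matrix_splitting.entry_unit[OF split[OF i] j] obtain u v x y
      where x: "x \<in> carrier (M i)" "y \<in> carrier (M i)"
      and unit: "\<And>l r s. l \<in> K i \<Longrightarrow> r < m i l \<Longrightarrow> s < m i l \<Longrightarrow>
        u * \<psi> i l x r s + v * \<psi> i l y r s = (if l = j \<and> r = p \<and> s = q then 1 else 0)"
      by blast
    \<comment> \<open>An element of one summand is extended by zero to the others; the other blocks
      then see only zero matrices.\<close>
    let ?ext = "\<lambda>x. \<lambda>i'\<in>I. if i' = i then x else zero (M i')"
    have "?ext x \<in> carrier (direct_sum_algebra I M)" "?ext y \<in> carrier (direct_sum_algebra I M)"
      using x matrix_splitting.zero_closed[OF split] by auto
    moreover have "u * (case l of (i, j) \<Rightarrow> \<lambda>x. \<psi> i j (x i)) (?ext x) r s +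
        v * (case l of (i, j) \<Rightarrow> \<lambda>x. \<psi> i j (x i)) (?ext y) r s =
        (if l = ij \<and> r = p \<and> s = q then 1 else 0)"
      if "l \<in> (SIGMA i:I. K i)" "r < (case l of (i, j) \<Rightarrow> m i j)" "s < (case l of (i, j) \<Rightarrow> m i j)"
      for l r s
    proof -
      obtain i' j' where l: "l = (i', j')" by (cases l)
      show ?thesis
        using that unit i by (cases "i' = i") (auto simp: ij l matrix_splitting.entry_zero[OF split])
    qed
    ultimately show "\<exists>u v. \<exists>x\<in>carrier (direct_sum_algebra I M). \<exists>y\<in>carrier (direct_sum_algebra I M).
        \<forall>l\<in>(SIGMA i:I. K i). \<forall>r<(case l of (i, j) \<Rightarrow> m i j). \<forall>s<(case l of (i, j) \<Rightarrow> m i j).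
        u * (case l of (i, j) \<Rightarrow> \<lambda>x. \<psi> i j (x i)) x r s +
        v * (case l of (i, j) \<Rightarrow> \<lambda>x. \<psi> i j (x i)) y r s =
        (if l = ij \<and> r = p \<and> s = q then 1 else 0)"
      by blast
  next
    fix x assume "x \<in> carrier (direct_sum_algebra I M)"
    then have x: "x i \<in> carrier (M i)" if "i \<in> I" for i using that by (auto simp: PiE_mem)
    have "\<forall>i\<in>I. \<exists>r. (\<Sum>j\<in>K i. of_nat (m i j) * (\<Sum>p<m i j. \<psi> i j (x i) p p)) = \<iota> r"
      using matrix_splitting.entry_trace[OF split x] by blast
    from bchoice[OF this] obtain r where r: "\<forall>i\<in>I.
        (\<Sum>j\<in>K i. of_nat (m i j) * (\<Sum>p<m i j. \<psi> i j (x i) p p)) = \<iota> (r i)"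
      by blast
    have "(\<Sum>ij\<in>(SIGMA i:I. K i). of_nat (case ij of (i, j) \<Rightarrow> m i j) *
        (\<Sum>p<(case ij of (i, j) \<Rightarrow> m i j). (case ij of (i, j) \<Rightarrow> \<lambda>x. \<psi> i j (x i)) x p p)) =
      (\<Sum>i\<in>I. \<Sum>j\<in>K i. of_nat (m i j) * (\<Sum>p<m i j. \<psi> i j (x i) p p))"
      using I split by (subst sum.Sigma)
        (auto dest: matrix_splitting.finite_index simp: case_prod_beta)
    also have "\<dots> = \<iota> (\<Sum>i\<in>I. r i)"
      by (simp add: r emb.hom_sum)
    finally show "\<exists>r. (\<Sum>ij\<in>(SIGMA i:I. K i). of_nat (case ij of (i, j) \<Rightarrow> m i j) *
        (\<Sum>p<(case ij of (i, j) \<Rightarrow> m i j). (case ij of (i, j) \<Rightarrow> \<lambda>x. \<psi> i j (x i)) x p p)) = \<iota> r"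
      by blast
  qed (auto simp: mem matrix_splitting.entry_zero[OF split] matrix_splitting.entry_one[OF split]
      matrix_splitting.entry_add[OF split] matrix_splitting.entry_scale[OF split]
      matrix_splitting.entry_mult[OF split])
qed

section \<open>Block matrices: from a splitting of the coefficients to one of the matrix
  algebra\<close>

lemma sum_lessThan_mult:
  fixes f :: "nat \<Rightarrow> 'c::comm_monoid_add"
  shows "(\<Sum>i<n * k. f i) = (\<Sum>a<n. \<Sum>b<k. f (a * k + b))"
proof -
  have "(\<Sum>i\<in>{a * k..<a * k + k}. f i) = (\<Sum>b<k. f (a * k + b))" for a
    using sum.shift_bounds_nat_ivl[of f 0 "a * k" k] by (simp add: lessThan_atLeast0 add.commute)
  then show ?thesis by (simp flip: sum.nat_group)
qed

text \<open>Each entry is replaced by its own \<open>k j\<close> by \<open>k j\<close> matrix. An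
  index \<open>p\<close> encodes the pair of block position \<open>p div k j\<close> and inner
  position \<open>p mod k j\<close>, so each property reduces to that of \<open>\<theta>\<close> on
  entries.\<close>

lemma matrix_splitting_mat_algebra:
  fixes s :: "'k::field \<Rightarrow> 'd::ring_1 \<Rightarrow> 'd" and \<iota> :: "'k \<Rightarrow> 'c::field"
  assumes "matrix_splitting \<iota> (ring_algebra s) J k \<theta>" and n: "0 < n"
  shows "matrix_splitting \<iota> (mat_algebra s n) J (\<lambda>j. n * k j)
    (\<lambda>j x p q. \<theta> j (x $$ (p div k j, q div k j)) (p mod k j) (q mod k j))"
proof -
  interpret D: matrix_splitting \<iota> "ring_algebra s" J k \<theta> by fact
  have zero: "\<theta> j 0 p q = 0" and one: "\<theta> j 1 p q = (if p = q then 1 else 0)"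
    and add: "\<theta> j (x + y) p q = \<theta> j x p q + \<theta> j y p q"
    and scale: "\<theta> j (s r x) p q = \<iota> r * \<theta> j x p q"
    and mult: "\<theta> j (x * y) p q = (\<Sum>r<k j. \<theta> j x p r * \<theta> j y r q)"
    if "j \<in> J" "p < k j" "q < k j" for j p q r x y
    using D.entry_zero[of j p q] D.entry_one[of j p q] D.entry_add[of x y j p q]
      D.entry_scale[of x j p q r] D.entry_mult[of x y j p q] that by (simp_all add: ring_algebra_def)
  have sum: "\<theta> j (\<Sum>i\<in>A. f i) p q = (\<Sum>i\<in>A. \<theta> j (f i) p q)"
    if "j \<in> J" "p < k j" "q < k j" for j p q A and f :: "nat \<Rightarrow> 'd"
    by (induction A rule: infinite_finite_induct) (simp_all add: zero add that)
  note [simp] = mat_algebra_def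
  have div_mod: "p div k j < n" "p mod k j < k j" if "j \<in> J" "p < n * k j" for p j
    using that D.size_pos[of j] by (auto simp: less_mult_imp_div_less)
  show ?thesis
  proof unfold_locales
    show "finite J" by (rule D.finite_index)
    show "0 < n * k j" if "j \<in> J" for j
      using n D.size_pos[OF that] by simp
    show "zero (mat_algebra s n) \<in> carrier (mat_algebra s n)" by simp
  next
    fix j p q assume j: "j \<in> J" "p < n * k j" "q < n * k j"
    note pq = div_mod[OF j(1,2)] div_mod[OF j(1,3)]
    show "\<theta> j (zero (mat_algebra s n) $$ (p div k j, q div k j)) (p mod k j) (q mod k j) = 0"
      using j pq by (simp add: zero)
    have "p = q \<longleftrightarrow> p div k j = q div k j \<and> p mod k j = q mod k j"
      by (metis div_mult_mod_eq)
    then show "\<theta> j (one (mat_algebra s n) $$ (p div k j, q div k j)) (p mod k j) (q mod k j) =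
        (if p = q then 1 else 0)"
      using j pq by (simp add: zero one)
  next
    fix x y j p q assume "x \<in> carrier (mat_algebra s n)" "y \<in> carrier (mat_algebra s n)"
      and j: "j \<in> J" "p < n * k j" "q < n * k j"
    then have x: "x \<in> carrier_mat n n" and y: "y \<in> carrier_mat n n" by simp_all
    note pq = div_mod[OF j(1,2)] div_mod[OF j(1,3)]
    show "\<theta> j (add (mat_algebra s n) x y $$ (p div k j, q div k j)) (p mod k j) (q mod k j) =
        \<theta> j (x $$ (p div k j, q div k j)) (p mod k j) (q mod k j) +
        \<theta> j (y $$ (p div k j, q div k j)) (p mod k j) (q mod k j)"
      using x y j pq by (simp add: add)
    have "\<theta> j (mult (mat_algebra s n) x y $$ (p div k j, q div k j)) (p mod k j) (q mod k j) =
        (\<Sum>a<n. \<Sum>b<k j. \<theta> j (x $$ (p div k j, a)) (p mod k j) b *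
          \<theta> j (y $$ (a, q div k j)) b (q mod k j))"
      using x y j pq by (simp add: scalar_prod_def sum mult flip: lessThan_atLeast0)
    then show "\<theta> j (mult (mat_algebra s n) x y $$ (p div k j, q div k j)) (p mod k j) (q mod k j) =
        (\<Sum>r<n * k j. \<theta> j (x $$ (p div k j, r div k j)) (p mod k j) (r mod k j) *
          \<theta> j (y $$ (r div k j, q div k j)) (r mod k j) (q mod k j))"
      by (simp add: sum_lessThan_mult)
  next
    fix x j p q r assume "x \<in> carrier (mat_algebra s n)"
      and j: "j \<in> J" "p < n * k j" "q < n * k j"
    then show "\<theta> j (smult (mat_algebra s n) r x $$ (p div k j, q div k j)) (p mod k j) (q mod k j) =
        \<iota> r * \<theta> j (x $$ (p div k j, q div k j)) (p mod k j) (q mod k j)"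
      using div_mod[OF j(1,2)] div_mod[OF j(1,3)] by (simp add: scale)
  next
    fix x y assume "x \<in> carrier (mat_algebra s n)" "y \<in> carrier (mat_algebra s n)"
      and eq: "\<And>j p q. j \<in> J \<Longrightarrow> p < n * k j \<Longrightarrow> q < n * k j \<Longrightarrow>
        \<theta> j (x $$ (p div k j, q div k j)) (p mod k j) (q mod k j) =
        \<theta> j (y $$ (p div k j, q div k j)) (p mod k j) (q mod k j)"
    then have x: "x \<in> carrier_mat n n" and y: "y \<in> carrier_mat n n" by simp_all
    have "x $$ (a, b) = y $$ (a, b)" if "a < n" "b < n" for a b
    proof (rule D.entry_inj)
      fix j p q assume j: "j \<in> J" "p < k j" "q < k j"
      have "a * k j + p < n * k j" "b * k j + q < n * k j"
        using that j mult_le_mono1[of "Suc a" n "k j"] mult_le_mono1[of "Suc b" n "k j"] by auto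
      from eq[OF j(1) this] show "\<theta> j (x $$ (a, b)) p q = \<theta> j (y $$ (a, b)) p q"
        using j by simp
    qed (simp_all add: ring_algebra_def)
    then show "x = y"
      using x y by (intro eq_matI) auto
  next
    fix j p q assume j: "j \<in> J" "p < n * k j" "q < n * k j"
    note pq = div_mod[OF j(1,2)] div_mod[OF j(1,3)]
    obtain u v x y where unit: "\<And>l r t. l \<in> J \<Longrightarrow> r < k l \<Longrightarrow> t < k l \<Longrightarrow>
        u * \<theta> l x r t + v * \<theta> l y r t =
        (if l = j \<and> r = p mod k j \<and> t = q mod k j then 1 else 0)"
      using D.entry_unit[OF j(1) pq(2,4)] by blast
    \<comment> \<open>The matrix unit at (p, q) has a single nonzero block, filled with an inner
      matrix unit.\<close>
    let ?mat = "\<lambda>x. mat n n (\<lambda>(a, b). if a = p div k j \<and> b = q div k j then x else 0)"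
    have "u * \<theta> l (?mat x $$ (r div k l, t div k l)) (r mod k l) (t mod k l) +
        v * \<theta> l (?mat y $$ (r div k l, t div k l)) (r mod k l) (t mod k l) =
        (if l = j \<and> r = p \<and> t = q then 1 else 0)"
      if l: "l \<in> J" "r < n * k l" "t < n * k l" for l r t
    proof -
      note rt = div_mod[OF l(1,2)] div_mod[OF l(1,3)]
      have eq_iff: "a = b \<longleftrightarrow> a div k j = b div k j \<and> a mod k j = b mod k j" for a b
        by (metis div_mult_mod_eq)
      have "u * \<theta> l (?mat x $$ (r div k l, t div k l)) (r mod k l) (t mod k l) +
          v * \<theta> l (?mat y $$ (r div k l, t div k l)) (r mod k l) (t mod k l) =
        (if r div k l = p div k j \<and> t div k l = q div k j
         then u * \<theta> l x (r mod k l) (t mod k l) + v * \<theta> l y (r mod k l) (t mod k l) else 0)"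
        using rt by (simp add: zero l(1))
      \<comment> \<open>For \<open>l\<close> different from \<open>j\<close> the block positions
        compared here use different block sizes, but \<open>unit\<close> makes the value zero
        anyway.\<close>
      also have "\<dots> = (if l = j \<and> r = p \<and> t = q then 1 else 0)"
        unfolding unit[OF l(1) rt(2,4)] using eq_iff[of r p] eq_iff[of t q] by (simp only: split: if_split) blast
      finally show ?thesis .
    qed
    then show "\<exists>u v. \<exists>x\<in>carrier (mat_algebra s n). \<exists>y\<in>carrier (mat_algebra s n).
        \<forall>l\<in>J. \<forall>r<n * k l. \<forall>t<n * k l.
        u * \<theta> l (x $$ (r div k l, t div k l)) (r mod k l) (t mod k l) +
        v * \<theta> l (y $$ (r div k l, t div k l)) (r mod k l) (t mod k l) =
        (if l = j \<and> r = p \<and> t = q then 1 else 0)"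
      by (intro exI[of _ u] exI[of _ v] bexI[of _ "?mat x"] bexI[of _ "?mat y"]) simp_all
  next
    fix x :: "'d mat"
    have "\<forall>a. \<exists>r. (\<Sum>j\<in>J. of_nat (k j) * (\<Sum>p<k j. \<theta> j (x $$ (a, a)) p p)) = \<iota> r"
      using D.entry_trace by (simp add: ring_algebra_def)
    then obtain r where r: "\<And>a. (\<Sum>j\<in>J. of_nat (k j) * (\<Sum>p<k j. \<theta> j (x $$ (a, a)) p p)) = \<iota> (r a)"
      by metis
    \<comment> \<open>The regular trace of a matrix is \<open>n\<close> times the sum of the regular
      traces of its diagonal entries.\<close>
    have "(\<Sum>j\<in>J. of_nat (n * k j) * (\<Sum>p<n * k j. \<theta> j (x $$ (p div k j, p div k j)) (p mod k j) (p mod k j))) =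
        (\<Sum>j\<in>J. of_nat n * (\<Sum>a<n. of_nat (k j) * (\<Sum>p<k j. \<theta> j (x $$ (a, a)) p p)))"
      by (simp add: sum_lessThan_mult sum_distrib_left mult.assoc)
    also have "\<dots> = of_nat n * (\<Sum>a<n. \<Sum>j\<in>J. of_nat (k j) * (\<Sum>p<k j. \<theta> j (x $$ (a, a)) p p))"
      by (subst sum.swap) (simp add: sum_distrib_left)
    also have "\<dots> = \<iota> (of_nat n * (\<Sum>a<n. r a))"
      by (simp add: r D.emb.hom_sum D.emb.hom_mult D.emb.hom_of_nat)
    finally show "\<exists>r. (\<Sum>j\<in>J. of_nat (n * k j) *
        (\<Sum>p<n * k j. \<theta> j (x $$ (p div k j, p div k j)) (p mod k j) (p mod k j))) = \<iota> r"
      by blast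
  qed
qed

section \<open>Splittings of the coefficient algebras\<close>

lemma matrix_splitting_complex: "matrix_splitting id (ring_algebra ((*) :: complex \<Rightarrow> _)) {False} (\<lambda>_. 1) (\<lambda>_ x _ _. x)"
proof unfold_locales
  fix j p q
  show "\<exists>u v. \<exists>x\<in>carrier (ring_algebra ((*) :: complex \<Rightarrow> _)). \<exists>y\<in>carrier (ring_algebra ((*) :: complex \<Rightarrow> _)).
      \<forall>l\<in>{False}. \<forall>r<1. \<forall>s<1. u * x + v * y = (if l = j \<and> r = p \<and> s = q then 1 else (0::complex))"
    if "j \<in> {False}" "p < (1::nat)" "q < (1::nat)"
    using that by (intro exI[of _ 1] exI[of _ 0] bexI[of _ 1]) (simp_all add: ring_algebra_def)
qed (auto simp: ring_algebra_def)

lemma matrix_splitting_real: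
  "matrix_splitting complex_of_real (ring_algebra (scaleR :: real \<Rightarrow> real \<Rightarrow> real)) {False} (\<lambda>_. 1)
    (\<lambda>_ x _ _. of_real x)"
proof unfold_locales
  fix j p q
  show "\<exists>u v. \<exists>x\<in>carrier (ring_algebra (scaleR :: real \<Rightarrow> real \<Rightarrow> real)).
      \<exists>y\<in>carrier (ring_algebra (scaleR :: real \<Rightarrow> real \<Rightarrow> real)).
      \<forall>l\<in>{False}. \<forall>r<1. \<forall>s<1. u * complex_of_real x + v * of_real y =
        (if l = j \<and> r = p \<and> s = q then 1 else 0)"
    if "j \<in> {False}" "p < (1::nat)" "q < (1::nat)"
    using that by (intro exI[of _ 1] exI[of _ 0] bexI[of _ 1]) (simp_all add: ring_algebra_def)
qed (auto simp: ring_algebra_def)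

text \<open>Over \<complex> the real algebra \<complex> becomes a product of two copies of
  \<complex>, whose projections are the identity (\<open>False\<close>) and conjugation
  (\<open>True\<close>).\<close>

lemma matrix_splitting_complex_over_real:
  "matrix_splitting complex_of_real (ring_algebra (scaleR :: real \<Rightarrow> complex \<Rightarrow> complex)) UNIV (\<lambda>_. 1)
    (\<lambda>j x _ _. if j then cnj x else x)"
proof unfold_locales
  fix j p q
  show "\<exists>u v. \<exists>x\<in>carrier (ring_algebra (scaleR :: real \<Rightarrow> complex \<Rightarrow> complex)).
      \<exists>y\<in>carrier (ring_algebra (scaleR :: real \<Rightarrow> complex \<Rightarrow> complex)).
      \<forall>l\<in>UNIV. \<forall>r<1. \<forall>s<1. u * (if l then cnj x else x) + v * (if l then cnj y else y) =
        (if l = j \<and> r = p \<and> s = q then 1 else 0)"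
    if "p < (1::nat)" "q < (1::nat)"
    using that
    \<comment> \<open>These are the idempotents (1 \<otimes> 1 - i \<otimes> i) / 2 and (1 \<otimes>
      1 + i \<otimes> i) / 2 that separate the two copies.\<close>
    by (intro exI[of _ "1/2"] exI[of _ "if j then \<i>/2 else -\<i>/2"] bexI[of _ 1] bexI[of _ \<i>])
      (auto simp: ring_algebra_def)
next
  fix x y :: complex
  show "x = y" if "\<And>j p q. j \<in> UNIV \<Longrightarrow> p < (1::nat) \<Longrightarrow> q < (1::nat) \<Longrightarrow>
      (if j then cnj x else x) = (if j then cnj y else y)"
    using that[of False 0 0] by simp
  show "\<exists>r. (\<Sum>j\<in>UNIV. of_nat 1 * (\<Sum>p<(1::nat). if j then cnj x else x)) = complex_of_real r"
    by (intro exI[of _ "2 * Re x"]) (simp add: UNIV_bool complex_eq_iff)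
qed (auto simp: ring_algebra_def scaleR_conv_of_real)

text \<open>
  The quaternion \<open>z + w j\<close> with \<open>z, w\<close> complex corresponds to the matrix with rows
  \<open>(z, w)\<close> and \<open>(- cnj w, cnj z)\<close>.
\<close>

definition quat_entry :: "quat \<Rightarrow> nat \<Rightarrow> nat \<Rightarrow> complex" where
  "quat_entry x p q =
    (if p = 0 then (if q = 0 then Complex (q_re x) (q_i x) else Complex (q_j x) (q_k x))
     else (if q = 0 then Complex (- q_j x) (q_k x) else Complex (q_re x) (- q_i x)))"

text \<open>Over \<complex> the quaternions become all 2 by 2 matrices: the images of 1 and i span
  the diagonal matrices, those of j and k the antidiagonal ones, so two images suffice for each
  matrix unit.\<close>

lemma matrix_splitting_quat:
  "matrix_splitting complex_of_real (ring_algebra (scaleR :: real \<Rightarrow> quat \<Rightarrow> quat)) {False} (\<lambda>_. 2)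
    (\<lambda>_. quat_entry)"
proof unfold_locales
  fix x y j p q
  show "\<exists>u v. \<exists>x\<in>carrier (ring_algebra (scaleR :: real \<Rightarrow> quat \<Rightarrow> quat)).
      \<exists>y\<in>carrier (ring_algebra (scaleR :: real \<Rightarrow> quat \<Rightarrow> quat)).
      \<forall>l\<in>{False}. \<forall>r<2. \<forall>s<2. u * quat_entry x r s + v * quat_entry y r s =
        (if l = j \<and> r = p \<and> s = q then 1 else 0)"
    if pq: "j \<in> {False}" "p < (2::nat)" "q < (2::nat)"
  proof -
    note defs = ring_algebra_def quat_entry_def numeral_2_eq_2 All_less_Suc complex_eq_iff
    consider "p = 0" "q = 0" | "p = 0" "q = 1" | "p = 1" "q = 0" | "p = 1" "q = 1"
      using pq by (auto simp: less_2_cases_iff)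
    then show ?thesis
    proof cases
      case 1
      with pq show ?thesis
        by (intro exI[of _ "1/2"] exI[of _ "-\<i>/2"] bexI[of _ "Quat 1 0 0 0"] bexI[of _ "Quat 0 1 0 0"])
          (simp_all add: defs)
    next
      case 2
      with pq show ?thesis
        by (intro exI[of _ "1/2"] exI[of _ "-\<i>/2"] bexI[of _ "Quat 0 0 1 0"] bexI[of _ "Quat 0 0 0 1"])
          (simp_all add: defs)
    next
      case 3
      with pq show ?thesis
        by (intro exI[of _ "-1/2"] exI[of _ "-\<i>/2"] bexI[of _ "Quat 0 0 1 0"] bexI[of _ "Quat 0 0 0 1"])
          (simp_all add: defs)
    next
      case 4
      with pq show ?thesis
        by (intro exI[of _ "1/2"] exI[of _ "\<i>/2"] bexI[of _ "Quat 1 0 0 0"] bexI[of _ "Quat 0 1 0 0"])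
          (simp_all add: defs)
    qed
  qed
  show "quat_entry (mult (ring_algebra (scaleR :: real \<Rightarrow> quat \<Rightarrow> quat)) x y) p q =
      (\<Sum>r<2. quat_entry x p r * quat_entry y r q)"
    by (auto simp: ring_algebra_def quat_entry_def times_quat_def numeral_2_eq_2 complex_eq_iff
        algebra_simps)
  show "x = y" if "\<And>j p q. j \<in> {False} \<Longrightarrow> p < (2::nat) \<Longrightarrow> q < (2::nat) \<Longrightarrow> quat_entry x p q = quat_entry y p q"
    using that[of False 0 0] that[of False 0 1] by (simp add: quat_entry_def quat.expand)
next
  fix x
  show "\<exists>r. (\<Sum>j\<in>{False}. of_nat 2 * (\<Sum>p<2. quat_entry x p p)) = complex_of_real r"
    \<comment> \<open>The matrix trace is \<open>2 * q_re x\<close>, and the block size contributes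
      the other factor 2.\<close>
    by (intro exI[of _ "4 * q_re x"]) (simp add: quat_entry_def numeral_2_eq_2 complex_eq_iff)
qed (auto simp: ring_algebra_def quat_entry_def zero_quat_def one_quat_def plus_quat_def
    scaleR_quat_def complex_eq_iff less_2_cases_iff)

text \<open>A direct sum needs one index type for all its summands; \<open>bool\<close> has room for
  the two embeddings of \<complex>.\<close>

definition block_index :: "real_division_algebra \<Rightarrow> bool set" where
  "block_index D = (if D = Complex_DA then UNIV else {False})"

definition block_size :: "real_division_algebra \<Rightarrow> nat \<Rightarrow> nat" where
  "block_size D n = (if D = Quaternion_DA then n * 2 else n)"

lemma matrix_splitting_real_block:
  assumes "0 < n"
  shows "\<exists>\<psi>. matrix_splitting complex_of_real (real_block D n) (block_index D) (\<lambda>_. block_size D n) \<psi>"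
proof (cases D)
  case Real_DA
  then show ?thesis
    using matrix_splitting_transport[OF matrix_splitting_mat_algebra[OF matrix_splitting_real assms],
        of the_real_mat Real_Mat]
    by (auto simp: block_index_def block_size_def)
next
  case Complex_DA
  then show ?thesis
    using matrix_splitting_transport[OF matrix_splitting_mat_algebra[OF matrix_splitting_complex_over_real assms],
        of the_complex_mat Complex_Mat]
    by (auto simp: block_index_def block_size_def)
next
  case Quaternion_DA
  then show ?thesis
    using matrix_splitting_transport[OF matrix_splitting_mat_algebra[OF matrix_splitting_quat assms],
        of the_quaternion_mat Quaternion_Mat]
    by (auto simp: block_index_def block_size_def)
qed

section \<open>The invariant tensor\<close>

locale split_frobenius_algebra =
  symmetric_special_frobenius_algebra smul S \<epsilon> + matrix_splitting \<iota> "ring_algebra smul" J m \<psi>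
  for smul :: "'k::field \<Rightarrow> 'a::{ring,monoid_mult} \<Rightarrow> 'a" and S :: "'a set" and \<epsilon> :: "'a \<Rightarrow> 'k"
    and \<iota> :: "'k \<Rightarrow> 'c::field" and J :: "'j set" and m \<psi> +
  fixes R :: 'k
  assumes distinguished: "smul R (distinguished_element smul S \<epsilon>) = 1"
begin

lemmas rep_zero = entry_zero [unfolded ring_algebra_def, simplified]
  and rep_add = entry_add [unfolded ring_algebra_def, simplified]
  and rep_scale = entry_scale [unfolded ring_algebra_def, simplified]
  and rep_mult = entry_mult [unfolded ring_algebra_def, simplified]
  and rep_one = entry_one [unfolded ring_algebra_def, simplified]
  and rep_inj = entry_inj [unfolded ring_algebra_def, simplified]
  and rep_unit = entry_unit [unfolded ring_algebra_def, simplified]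
  and rep_trace = entry_trace [unfolded ring_algebra_def, simplified]

lemma rep_sum:
  assumes "j \<in> J" "p < m j" "q < m j"
  shows "\<psi> j (sum f I) p q = (\<Sum>i\<in>I. \<psi> j (f i) p q)"
  by (induction I rule: infinite_finite_induct) (simp_all add: rep_add rep_zero assms)

text \<open>The entry at (p, q) and (r, s) of the image of B under the tensor product of the
  representations \<open>j\<close> and \<open>l\<close>.\<close>

definition casimir :: "'j \<Rightarrow> nat \<Rightarrow> nat \<Rightarrow> 'j \<Rightarrow> nat \<Rightarrow> nat \<Rightarrow> 'c" where
  "casimir j p q l r s =
     (\<Sum>a\<in>S. \<Sum>b\<in>S. \<iota> (form_inverse S \<epsilon> a b) * \<psi> j a p q * \<psi> l b r s)"

lemma casimir_commute: "casimir j p q l r s = casimir l r s j p q"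
  unfolding casimir_def
  by (subst sum.swap) (intro sum.cong refl, simp add: form_inverse_commute mult_ac)

lemma casimir_dual:
  assumes "l \<in> J" "r < m l" "s < m l"
  shows "casimir j p q l r s = (\<Sum>a\<in>S. \<psi> j a p q * \<psi> l (dual_vector a) r s)"
proof -
  have "\<psi> l (dual_vector a) r s = (\<Sum>b\<in>S. \<iota> (form_inverse S \<epsilon> a b) * \<psi> l b r s)" if "a \<in> S" for a
    using that form_inverse_commute by (simp add: dual_vector_def rep_sum rep_scale assms cong: sum.cong)
  then show ?thesis
    by (simp add: casimir_def sum_distrib_left mult_ac cong: sum.cong)
qed

text \<open>In entries, this is (x \<otimes> 1) B = B (1 \<otimes> x). Expand \<open>x * a\<close>
  in the basis with coefficients \<open>\<epsilon> (x * a * dual_vector b)\<close>, move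
  \<open>x\<close> to the end by symmetry of the form, and collect the sum over \<open>a\<close>
  into \<open>dual_vector b * x\<close>.\<close>

lemma casimir_invariant:
  assumes j: "j \<in> J" "p < m j" "q < m j" and l: "l \<in> J" "r < m l" "s < m l"
  shows "(\<Sum>i<m j. \<psi> j x p i * casimir j i q l r s) = (\<Sum>i<m l. casimir j p q l r i * \<psi> l x i s)"
proof -
  have "(\<Sum>i<m j. \<psi> j x p i * casimir j i q l r s) =
      (\<Sum>a\<in>S. \<psi> j (x * a) p q * \<psi> l (dual_vector a) r s)"
    by (simp add: casimir_dual rep_mult j l sum_distrib_left sum_distrib_right mult_ac) (rule sum.swap)
  also have "\<dots> = (\<Sum>a\<in>S. (\<Sum>b\<in>S. \<iota> (\<epsilon> (x * a * dual_vector b)) * \<psi> j b p q) * \<psi> l (dual_vector a) r s)"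
  proof (rule sum.cong)
    fix a
    show "\<psi> j (x * a) p q * \<psi> l (dual_vector a) r s =
        (\<Sum>b\<in>S. \<iota> (\<epsilon> (x * a * dual_vector b)) * \<psi> j b p q) * \<psi> l (dual_vector a) r s"
      by (subst basis_expansion[of "x * a", symmetric]) (simp add: rep_sum rep_scale j)
  qed simp
  also have "\<dots> = (\<Sum>b\<in>S. \<psi> j b p q * (\<Sum>a\<in>S. \<iota> (\<epsilon> (x * a * dual_vector b)) * \<psi> l (dual_vector a) r s))"
    unfolding sum_distrib_left sum_distrib_right by (subst sum.swap) (simp add: mult_ac)
  also have "\<dots> = (\<Sum>b\<in>S. \<psi> j b p q * \<psi> l (dual_vector b * x) r s)"
  proof (rule sum.cong)
    fix b
    have eq: "\<epsilon> (x * a * dual_vector b) = \<epsilon> (a * (dual_vector b * x))" for a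
      using symmetric[of x "a * dual_vector b"] by (simp add: mult.assoc)
    show "\<psi> j b p q * (\<Sum>a\<in>S. \<iota> (\<epsilon> (x * a * dual_vector b)) * \<psi> l (dual_vector a) r s) =
        \<psi> j b p q * \<psi> l (dual_vector b * x) r s"
      by (subst dual_vector_expansion[of "dual_vector b * x", symmetric])
        (simp add: rep_sum rep_scale l eq)
  qed simp
  also have "\<dots> = (\<Sum>i<m l. casimir j p q l r i * \<psi> l x i s)"
    by (simp add: casimir_dual rep_mult j l sum_distrib_left sum_distrib_right mult_ac) (rule sum.swap)
  finally show ?thesis .
qed

text \<open>
  Invariance extends to the linear span of the image of the algebra, hence holds for matrix units.
\<close>

lemma casimir_unit:
  assumes j: "j \<in> J" "p < m j" "q < m j" "h < m j" and l: "l \<in> J" "r < m l" "s < m l"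
  shows "casimir j p q l r s = (if l = j \<and> s = p then casimir j h q l r h else 0)"
proof -
  \<comment> \<open>The combination plays the role of the matrix unit E_hp of block
    \<open>j\<close>. On the left of the first factor it trades row \<open>p\<close> for row
    \<open>h\<close>; on the right of the second it survives only for \<open>l = j\<close> and
    \<open>s = p\<close>.\<close>
  obtain u x v y where unit:
    "\<And>k i i'. k \<in> J \<Longrightarrow> i < m k \<Longrightarrow> i' < m k \<Longrightarrow>
      u * \<psi> k x i i' + v * \<psi> k y i i' = (if k = j \<and> i = h \<and> i' = p then 1 else 0)"
    using rep_unit[OF j(1,4,2)] by metis
  have "casimir j p q l r s = (\<Sum>i<m j. if i = p then casimir j i q l r s else 0)"
    using j by simp
  also have "\<dots> = (\<Sum>i<m j. (u * \<psi> j x h i + v * \<psi> j y h i) * casimir j i q l r s)"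
    by (rule sum.cong) (simp_all add: unit j)
  also have "\<dots> = u * (\<Sum>i<m j. \<psi> j x h i * casimir j i q l r s) +
      v * (\<Sum>i<m j. \<psi> j y h i * casimir j i q l r s)"
    by (simp add: sum_distrib_left sum.distrib algebra_simps)
  also have "\<dots> = u * (\<Sum>i<m l. casimir j h q l r i * \<psi> l x i s) +
      v * (\<Sum>i<m l. casimir j h q l r i * \<psi> l y i s)"
    by (simp add: casimir_invariant j l)
  also have "\<dots> = (\<Sum>i<m l. casimir j h q l r i * (u * \<psi> l x i s + v * \<psi> l y i s))"
    by (simp add: sum_distrib_left sum.distrib algebra_simps)
  also have "\<dots> = (\<Sum>i<m l. if i = h then (if l = j \<and> s = p then casimir j h q l r i else 0) else 0)"
    by (rule sum.cong) (simp_all add: unit l)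
  also have "\<dots> = (if l = j \<and> s = p then casimir j h q l r h else 0)"
    using j by auto
  finally show ?thesis .
qed

lemma distinguished_element_dual:
  "distinguished_element smul S \<epsilon> = (\<Sum>a\<in>S. a * dual_vector a)"
proof -
  have "(\<Sum>b\<in>S. smul (form_inverse S \<epsilon> a b) (a * b)) = a * dual_vector a" if "a \<in> S" for a
    using that form_inverse_commute
    by (simp add: dual_vector_def sum_distrib_left smul_mult_right cong: sum.cong)
  then show ?thesis by (simp add: distinguished_element_def)
qed

text \<open>This is the diagonal entry at \<open>p\<close> of R \<beta> = 1 in block
  \<open>j\<close>.\<close>

lemma casimir_trace:
  assumes "j \<in> J" "p < m j"
  shows "\<iota> R * (\<Sum>q<m j. casimir j p q j q p) = 1"
proof -
  have "1 = \<psi> j (smul R (distinguished_element smul S \<epsilon>)) p p"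
    by (simp add: distinguished rep_one assms)
  also have "\<dots> = \<iota> R * (\<Sum>a\<in>S. \<Sum>q<m j. \<psi> j a p q * \<psi> j (dual_vector a) q p)"
    by (simp add: rep_scale rep_sum rep_mult distinguished_element_dual assms)
  also have "\<dots> = \<iota> R * (\<Sum>q<m j. casimir j p q j q p)"
    by (subst sum.swap) (simp add: casimir_dual assms)
  finally show ?thesis by simp
qed

definition weight :: "'j \<Rightarrow> 'c" where
  "weight j = \<iota> R * of_nat (m j)"

text \<open>\<open>casimir_unit\<close> constrains the outer indices \<open>p\<close>,
  \<open>s\<close>; together with the exchange of the two factors it also constrains
  \<open>q\<close>, \<open>r\<close>. What remains is one constant per block, which the trace
  identity determines. That identity also shows that the weight is nonzero.\<close>

lemma casimir_eq:
  assumes j: "j \<in> J" "p < m j" "q < m j" and l: "l \<in> J" "r < m l" "s < m l"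
  shows "casimir j p q l r s = (if l = j \<and> s = p \<and> r = q then 1 / weight j else 0)"
    and "weight j \<noteq> 0"
proof -
  \<comment> \<open>The outer pair of indices is moved to 0, the factors are exchanged, and the
    former inner pair is moved to 0.\<close>
  have const: "casimir j a b j b a = casimir j 0 0 j 0 0" if "a < m j" "b < m j" for a b
  proof -
    have "casimir j a b j b a = casimir j 0 b j b 0"
      using casimir_unit[of j a b 0 j b a] that j size_pos by simp
    also have "\<dots> = casimir j b 0 j 0 b"
      by (rule casimir_commute)
    also have "\<dots> = casimir j 0 0 j 0 0"
      using casimir_unit[of j b 0 0 j 0 b] that j size_pos by simp
    finally show ?thesis .
  qed
  have diag: "weight j * casimir j 0 0 j 0 0 = 1"
  proof -
    have "(\<Sum>q<m j. casimir j 0 q j q 0) = (\<Sum>q<m j. casimir j 0 0 j 0 0)"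
      by (intro sum.cong refl const size_pos[OF j(1)]) simp
    then show ?thesis
      using casimir_trace[of j 0] size_pos[OF j(1)] j(1) by (simp add: weight_def mult.assoc)
  qed
  then show nz: "weight j \<noteq> 0" by auto
  show "casimir j p q l r s = (if l = j \<and> s = p \<and> r = q then 1 / weight j else 0)"
  proof (cases "l = j \<and> s = p")
    case True
    then have "casimir j p q l r s = casimir j r p j p q"
      by (simp add: casimir_commute)
    moreover have "casimir j 0 0 j 0 0 = 1 / weight j"
      using diag nz by (simp add: nonzero_eq_divide_eq mult.commute)
    ultimately show ?thesis
      using True casimir_unit[of j r p r j p q] const[of r p] j l by auto
  next
    case False
    then show ?thesis using casimir_unit[of j p q p l r s] j l by auto
  qed
qed

text \<open>Write t for the weighted trace form. Since B inverts t on each block, x is the sum of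
  t(x a) times the dual vector of a. Applying \<epsilon> and pulling its values inside t gives t(x
  y), where y is the sum of \<epsilon>(dual vector of a) times a, and y = 1.\<close>

lemma form_eq_trace: "\<iota> (\<epsilon> x) = (\<Sum>j\<in>J. weight j * (\<Sum>p<m j. \<psi> j x p p))"
proof -
  \<comment> \<open>Rationality of the regular trace: \<open>R * \<tau> x\<close> is t(x) as an
    element of the ground field, so it can scale vectors of the algebra.\<close>
  obtain \<tau> where "\<And>x. (\<Sum>j\<in>J. of_nat (m j) * (\<Sum>p<m j. \<psi> j x p p)) = \<iota> (\<tau> x)"
    using rep_trace by metis
  then have \<tau>: "(\<Sum>j\<in>J. weight j * (\<Sum>p<m j. \<psi> j x p p)) = \<iota> (R * \<tau> x)" for x
    by (simp add: weight_def emb.hom_mult mult.assoc flip: sum_distrib_left)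
  have expand: "(\<Sum>a\<in>S. smul (R * \<tau> (x * a)) (dual_vector a)) = x"
  proof (rule rep_inj)
    fix l r s assume l: "l \<in> J" "r < m l" "s < m l"
    have "\<psi> l (\<Sum>a\<in>S. smul (R * \<tau> (x * a)) (dual_vector a)) r s =
        (\<Sum>a\<in>S. (\<Sum>j\<in>J. weight j * (\<Sum>p<m j. \<Sum>q<m j. \<psi> j x p q * \<psi> j a q p)) *
          \<psi> l (dual_vector a) r s)"
      by (simp add: rep_sum rep_scale rep_mult l flip: \<tau>)
    also have "\<dots> = (\<Sum>a\<in>S. \<Sum>j\<in>J. \<Sum>p<m j. \<Sum>q<m j.
        weight j * \<psi> j x p q * (\<psi> j a q p * \<psi> l (dual_vector a) r s))"
      by (simp add: sum_distrib_left sum_distrib_right mult_ac)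
    also have "\<dots> = (\<Sum>j\<in>J. \<Sum>p<m j. \<Sum>q<m j. weight j * \<psi> j x p q * casimir j q p l r s)"
      unfolding casimir_dual[OF l] sum_distrib_left
      by (subst sum.swap, intro sum.cong refl, subst sum.swap, intro sum.cong refl, rule sum.swap)
    \<comment> \<open>The weight cancels the value 1 / weight of the invariant tensor, leaving only
      \<open>j = l\<close>, \<open>p = r\<close> and \<open>q = s\<close>.\<close>
    also have "\<dots> = (\<Sum>j\<in>J. if j = l then (\<Sum>p<m j. if p = r then
        (\<Sum>q<m j. if q = s then \<psi> j x p q else 0) else 0) else 0)"
    proof (intro sum.cong refl)
      fix j assume j: "j \<in> J"
      have "weight j * \<psi> j x p q * casimir j q p l r s =
          (if j = l then if p = r then if q = s then \<psi> j x p q else 0 else 0 else 0)"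
        if "p < m j" "q < m j" for p q
        using casimir_eq(2)[OF l l] that j by (simp add: casimir_eq(1) l)
      then have "(\<Sum>q<m j. weight j * \<psi> j x p q * casimir j q p l r s) =
          (if j = l then if p = r then (\<Sum>q<m j. if q = s then \<psi> j x p q else 0) else 0 else 0)"
        if "p < m j" for p
        using that by (auto intro!: sum.cong sum.neutral)
      then show "(\<Sum>p<m j. \<Sum>q<m j. weight j * \<psi> j x p q * casimir j q p l r s) =
          (if j = l then (\<Sum>p<m j. if p = r then (\<Sum>q<m j. if q = s then \<psi> j x p q else 0) else 0) else 0)"
        by (auto intro!: sum.cong sum.neutral)
    qed
    also have "\<dots> = \<psi> l x r s"
      using l finite_index by simp
    finally show "\<psi> l (\<Sum>a\<in>S. smul (R * \<tau> (x * a)) (dual_vector a)) r s = \<psi> l x r s" .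
  qed
  have trace_sum: "R * \<tau> (\<Sum>a\<in>S. smul (c a) (f a)) = (\<Sum>a\<in>S. c a * (R * \<tau> (f a)))" for c f
  proof -
    have "\<iota> (R * \<tau> (\<Sum>a\<in>S. smul (c a) (f a))) = \<iota> (\<Sum>a\<in>S. c a * (R * \<tau> (f a)))"
      unfolding emb.hom_sum emb.hom_mult[of _ "R * _"] \<tau>[symmetric]
      by (simp add: rep_sum rep_scale sum_distrib_left mult_ac)
        (subst (2) sum.swap, intro sum.cong refl, rule sum.swap)
    then show ?thesis by simp
  qed
  have "\<epsilon> x = \<epsilon> (\<Sum>a\<in>S. smul (R * \<tau> (x * a)) (dual_vector a))"
    by (simp add: expand)
  \<comment> \<open>The factor 1 is inserted to match \<open>basis_expansion\<close> at the
    unit.\<close>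
  also have "\<dots> = (\<Sum>a\<in>S. \<epsilon> (1 * dual_vector a) * (R * \<tau> (x * a)))"
    by (simp add: form_sum form_scale mult_ac)
  also have "\<dots> = R * \<tau> (x * (\<Sum>a\<in>S. smul (\<epsilon> (1 * dual_vector a)) a))"
    by (simp only: trace_sum[symmetric] sum_distrib_left smul_mult_right)
  also have "\<dots> = R * \<tau> x"
    by (simp only: basis_expansion mult_1_right)
  finally show ?thesis by (simp add: \<tau>)
qed

end

section \<open>Combinatorics of closed surfaces\<close>

text \<open>A state on both sides of all edges is one pair of basis vectors per edge, so by
  distributivity the pairs can be summed independently.\<close>

lemma sum_PiE_paired:
  fixes F :: "'d \<Rightarrow> 'a \<Rightarrow> 'a \<Rightarrow> 'k::comm_semiring_1"
  assumes "finite X" "finite S" "inj_on g X" "X \<inter> g ` X = {}"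
  shows "(\<Sum>s \<in> (X \<union> g ` X) \<rightarrow>\<^sub>E S. \<Prod>d\<in>X. F d (s d) (s (g d))) =
    (\<Prod>d\<in>X. \<Sum>a\<in>S. \<Sum>b\<in>S. F d a b)"
proof -
  define h where "h = the_inv_into X g"
  have h: "h (g d) = d" if "d \<in> X" for d
    using that assms(3) by (simp add: h_def the_inv_into_f_f)
  have disj: "g d \<notin> X" if "d \<in> X" for d
    using that assms(4) by auto
  have "(\<Prod>d\<in>X. \<Sum>a\<in>S. \<Sum>b\<in>S. F d a b) = (\<Prod>d\<in>X. \<Sum>c\<in>S\<times>S. F d (fst c) (snd c))"
    by (simp add: sum.cartesian_product case_prod_beta)
  also have "\<dots> = (\<Sum>f \<in> X \<rightarrow>\<^sub>E S \<times> S. \<Prod>d\<in>X. F d (fst (f d)) (snd (f d)))"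
    using assms by (intro prod_sum_PiE) auto
  also have "\<dots> = (\<Sum>s \<in> (X \<union> g ` X) \<rightarrow>\<^sub>E S. \<Prod>d\<in>X. F d (s d) (s (g d)))"
  proof (rule sum.reindex_bij_witness[where
        i = "\<lambda>s. \<lambda>d\<in>X. (s d, s (g d))" and
        j = "\<lambda>f. \<lambda>d\<in>X \<union> g ` X. if d \<in> X then fst (f d) else snd (f (h d))"])
    fix f assume f: "f \<in> X \<rightarrow>\<^sub>E S \<times> S"
    show "(\<lambda>d\<in>X. ((\<lambda>d\<in>X \<union> g ` X. if d \<in> X then fst (f d) else snd (f (h d))) d,
        (\<lambda>d\<in>X \<union> g ` X. if d \<in> X then fst (f d) else snd (f (h d))) (g d))) = f"
      using f by (intro ext) (auto simp: h disj PiE_def extensional_def)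
    show "(\<lambda>d\<in>X \<union> g ` X. if d \<in> X then fst (f d) else snd (f (h d))) \<in> (X \<union> g ` X) \<rightarrow>\<^sub>E S"
      using f by (force simp: h PiE_def Pi_def)
    show "(\<Prod>d\<in>X. F d ((\<lambda>d\<in>X \<union> g ` X. if d \<in> X then fst (f d) else snd (f (h d))) d)
        ((\<lambda>d\<in>X \<union> g ` X. if d \<in> X then fst (f d) else snd (f (h d))) (g d))) =
      (\<Prod>d\<in>X. F d (fst (f d)) (snd (f d)))"
      by (intro prod.cong) (simp_all add: h disj)
  next
    fix s assume s: "s \<in> (X \<union> g ` X) \<rightarrow>\<^sub>E S"
    show "(\<lambda>d\<in>X \<union> g ` X. if d \<in> X then fst ((\<lambda>d\<in>X. (s d, s (g d))) d)
        else snd ((\<lambda>d\<in>X. (s d, s (g d))) (h d))) = s"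
      using s by (intro ext) (auto simp: h disj PiE_def extensional_def)
    show "(\<lambda>d\<in>X. (s d, s (g d))) \<in> X \<rightarrow>\<^sub>E S \<times> S"
      using s by (auto simp: PiE_def Pi_def)
  qed
  finally show ?thesis by simp
qed

lemma next_edge_in_triangle_edges:
  "d \<in> triangle_edges T \<Longrightarrow> next_edge d \<in> triangle_edges T"
  by (auto simp: triangle_edges_def next_edge_def)

lemma fst_next_edge [simp]: "fst (next_edge d) = fst d"
  by (simp add: next_edge_def)

locale closed_surface =
  fixes T :: "'t triangulation"
  assumes closed_surface: "closed_surface_triangulation T"
begin

lemma finite_triangles: "finite (triangles T)"
  using closed_surface by (simp add: closed_surface_triangulation_def)

lemma finite_triangle_edges: "finite (triangle_edges T)"
  by (simp add: triangle_edges_def finite_triangles)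

lemma glue:
  assumes "d \<in> triangle_edges T"
  shows "glue T d \<in> triangle_edges T" "glue T d \<noteq> d" "glue T (glue T d) = d"
  using assms closed_surface by (auto simp: closed_surface_triangulation_def)

text \<open>The choice is the one made in \<open>edge_amplitude\<close>, so that amplitudes can be
  rewritten as a product over chosen sides.\<close>

definition edge_side :: "('t \<times> nat) set \<Rightarrow> 't \<times> nat" where
  "edge_side e = (SOME d. d \<in> e)"

definition edge_sides :: "('t \<times> nat) set" where
  "edge_sides = edge_side ` surface_edges T"

lemma edge_side:
  assumes "e \<in> surface_edges T"
  shows "edge_side e \<in> triangle_edges T" "e = {edge_side e, glue T (edge_side e)}"
proof -
  obtain d where d: "d \<in> triangle_edges T" "e = {d, glue T d}"
    using assms by (auto simp: surface_edges_def)
  have "edge_side e \<in> e"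
    unfolding edge_side_def by (rule someI[of _ d]) (simp add: d)
  then show "edge_side e \<in> triangle_edges T" "e = {edge_side e, glue T (edge_side e)}"
    using d(2) glue[OF d(1)] d(1) by (metis insert_iff insert_commute singletonD)+
qed

lemma inj_on_edge_side: "inj_on edge_side (surface_edges T)"
  by (rule inj_onI) (metis edge_side(2))

lemma edge_sides_subset: "edge_sides \<subseteq> triangle_edges T"
  using edge_side(1) by (auto simp: edge_sides_def)

lemma finite_edge_sides: "finite edge_sides"
  using edge_sides_subset finite_triangle_edges finite_subset by blast

lemma card_edge_sides: "card edge_sides = card (surface_edges T)"
  by (simp add: edge_sides_def card_image inj_on_edge_side)

lemma inj_on_glue: "inj_on (glue T) edge_sides"
  by (rule inj_onI) (metis edge_sides_subset glue(3) subsetD)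

text \<open>A chosen side that is the partner of a chosen side belongs to the same edge, hence would
  be its own partner, which the gluing excludes.\<close>

lemma edge_sides_disjoint: "edge_sides \<inter> glue T ` edge_sides = {}"
proof (rule ccontr)
  assume "edge_sides \<inter> glue T ` edge_sides \<noteq> {}"
  then obtain e e' where e: "e \<in> surface_edges T" "e' \<in> surface_edges T"
    and eq: "edge_side e = glue T (edge_side e')"
    unfolding edge_sides_def by blast
  then have "e = e'"
    using edge_side glue(3) by (metis insert_commute)
  then show False
    using e eq edge_side(1) glue(2) by metis
qed

lemma edge_sides_cover: "edge_sides \<union> glue T ` edge_sides = triangle_edges T"
proof
  show "edge_sides \<union> glue T ` edge_sides \<subseteq> triangle_edges T"
    using edge_sides_subset glue(1) by auto
  show "triangle_edges T \<subseteq> edge_sides \<union> glue T ` edge_sides"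
  proof
    fix d assume "d \<in> triangle_edges T"
    then have "{d, glue T d} \<in> surface_edges T"
      by (auto simp: surface_edges_def)
    from edge_side(2)[OF this] this show "d \<in> edge_sides \<union> glue T ` edge_sides"
      by (auto simp: edge_sides_def)
  qed
qed

lemma prod_triangle_edges:
  fixes f :: "'t \<times> nat \<Rightarrow> 'k::comm_monoid_mult"
  shows "prod f (triangle_edges T) = (\<Prod>d\<in>edge_sides. f d * f (glue T d))"
  by (simp add: prod.distrib prod.union_disjoint[OF finite_edge_sides _ edge_sides_disjoint]
      finite_edge_sides prod.reindex[OF inj_on_glue] flip: edge_sides_cover)

lemma prod_edge_amplitude:
  "(\<Prod>e\<in>surface_edges T. edge_amplitude S \<epsilon> T s e) =
     (\<Prod>d\<in>edge_sides. form_inverse S \<epsilon> (s d) (s (glue T d)))"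
  unfolding edge_sides_def prod.reindex[OF inj_on_edge_side]
  by (simp add: edge_amplitude_def edge_side_def Let_def)

section \<open>Vertices as classes of corners\<close>

definition vertex_rel :: "(('t \<times> nat) \<times> ('t \<times> nat)) set" where
  "vertex_rel = {(c, c'). c \<in> triangle_edges T \<and>
     equivclp (\<lambda>d d'. d \<in> triangle_edges T \<and> d' = next_edge (glue T d)) c c'}"

lemma surface_vertices_eq: "surface_vertices T = triangle_edges T // vertex_rel"
  by (simp add: surface_vertices_def vertex_rel_def)

lemma equiv_vertex_rel: "equiv (triangle_edges T) vertex_rel"
proof -
  let ?r = "\<lambda>d d'. d \<in> triangle_edges T \<and> d' = next_edge (glue T d)"
  have "c' \<in> triangle_edges T" if "equivclp ?r c c'" "c \<in> triangle_edges T" for c c'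
    using that
    by (induction rule: equivclp_induct) (blast intro: next_edge_in_triangle_edges glue(1))+
  then show ?thesis
    unfolding equiv_def refl_on_def sym_def trans_def vertex_rel_def
    by (auto intro: equivclp_sym equivclp_trans)
qed

lemma vertex_relI: "d \<in> triangle_edges T \<Longrightarrow> (d, next_edge (glue T d)) \<in> vertex_rel"
  by (auto simp: vertex_rel_def)

lemma vertex_rel_invariant:
  assumes "(c, c') \<in> vertex_rel"
    and "\<And>d. d \<in> triangle_edges T \<Longrightarrow> f d = f (next_edge (glue T d))"
  shows "f c = f c'"
proof -
  have "equivclp (\<lambda>d d'. d \<in> triangle_edges T \<and> d' = next_edge (glue T d)) c c'"
    using assms(1) by (simp add: vertex_rel_def)
  then show ?thesis
    by (induction rule: equivclp_induct) (use assms(2) in auto)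
qed

lemma finite_surface_vertices: "finite (surface_vertices T)"
  unfolding surface_vertices_eq
  using finite_triangle_edges equiv_type[OF equiv_vertex_rel] by (rule finite_quotient)

text \<open>
  A corner labelling that is compatible with the gluing is the same as a labelling of the vertices.
\<close>

lemma card_corner_labellings:
  fixes m :: nat
  shows "card {f \<in> triangle_edges T \<rightarrow>\<^sub>E {..<m}.
      \<forall>d\<in>triangle_edges T. f d = f (next_edge (glue T d))} = m ^ card (surface_vertices T)"
    (is "card ?F = _")
proof -
  let ?cls = "\<lambda>d. vertex_rel `` {d}"
  have cls: "?cls d \<in> surface_vertices T" if "d \<in> triangle_edges T" for d
    using that by (auto simp: surface_vertices_eq quotient_def)
  have "bij_betw (\<lambda>v. \<lambda>d\<in>triangle_edges T. v (?cls d)) (surface_vertices T \<rightarrow>\<^sub>E {..<m}) ?F"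
  proof (rule bij_betw_imageI)
    show "inj_on (\<lambda>v. \<lambda>d\<in>triangle_edges T. v (?cls d)) (surface_vertices T \<rightarrow>\<^sub>E {..<m})"
    proof (rule inj_onI)
      fix v w assume vw: "v \<in> surface_vertices T \<rightarrow>\<^sub>E {..<m}" "w \<in> surface_vertices T \<rightarrow>\<^sub>E {..<m}"
        and eq: "(\<lambda>d\<in>triangle_edges T. v (?cls d)) = (\<lambda>d\<in>triangle_edges T. w (?cls d))"
      show "v = w"
      proof (rule PiE_ext[OF vw])
        fix V assume "V \<in> surface_vertices T"
        then obtain d where "d \<in> triangle_edges T" "V = ?cls d"
          by (auto simp: surface_vertices_eq quotient_def)
        then show "v V = w V"
          using fun_cong[OF eq, of d] by simp
      qed
    qed
    show "(\<lambda>v. \<lambda>d\<in>triangle_edges T. v (?cls d)) ` (surface_vertices T \<rightarrow>\<^sub>E {..<m}) = ?F"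
    proof (intro equalityI subsetI)
      fix f assume "f \<in> (\<lambda>v. \<lambda>d\<in>triangle_edges T. v (?cls d)) ` (surface_vertices T \<rightarrow>\<^sub>E {..<m})"
      then obtain v where v: "v \<in> surface_vertices T \<rightarrow>\<^sub>E {..<m}"
        and f: "f = (\<lambda>d\<in>triangle_edges T. v (?cls d))" by auto
      have "?cls d = ?cls (next_edge (glue T d))" if "d \<in> triangle_edges T" for d
        using equiv_class_eq[OF equiv_vertex_rel vertex_relI[OF that]] .
      then have "f d = f (next_edge (glue T d))" if "d \<in> triangle_edges T" for d
        using arg_cong[of "?cls d" "?cls (next_edge (glue T d))" v] that
        by (simp only: f restrict_apply' glue(1) next_edge_in_triangle_edges)
      moreover have "f \<in> triangle_edges T \<rightarrow>\<^sub>E {..<m}"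
        using v cls by (auto simp: f)
      ultimately show "f \<in> ?F" by blast
    next
      fix f assume f: "f \<in> ?F"
      then have fP: "f \<in> triangle_edges T \<rightarrow>\<^sub>E {..<m}" by simp
      \<comment> \<open>Any corner of the vertex may be used, since \<open>f\<close> is constant on
        classes by \<open>vertex_rel_invariant\<close>.\<close>
      define v where "v = (\<lambda>V\<in>surface_vertices T. f (SOME d. d \<in> V))"
      have some: "(d, SOME d'. d' \<in> ?cls d) \<in> vertex_rel" if "d \<in> triangle_edges T" for d
        using someI[of "\<lambda>d'. d' \<in> ?cls d" d] equiv_class_self[OF equiv_vertex_rel that] by simp
      have v_cls: "v (?cls d) = f d" if "d \<in> triangle_edges T" for d
        using vertex_rel_invariant[OF some[OF that], of f] f cls that by (simp add: v_def)
      have "v \<in> surface_vertices T \<rightarrow>\<^sub>E {..<m}"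
      proof (rule PiE_I)
        fix V assume "V \<in> surface_vertices T"
        then obtain d where "d \<in> triangle_edges T" "V = ?cls d"
          by (auto simp: surface_vertices_eq quotient_def)
        then show "v V \<in> {..<m}" using v_cls[of d] PiE_mem[OF fP, of d] by simp
      qed (simp add: v_def)
      moreover have "f = (\<lambda>d\<in>triangle_edges T. v (?cls d))"
      proof (rule ext)
        show "f d = (\<lambda>d\<in>triangle_edges T. v (?cls d)) d" for d
          using v_cls[of d] PiE_arb[OF fP, of d] by (cases "d \<in> triangle_edges T") simp_all
      qed
      ultimately show "f \<in> (\<lambda>v. \<lambda>d\<in>triangle_edges T. v (?cls d)) ` (surface_vertices T \<rightarrow>\<^sub>E {..<m})"
        by blast
    qed
  qed
  then have "card ?F = card (surface_vertices T \<rightarrow>\<^sub>E {..<m})"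
    by (rule bij_betw_same_card[symmetric])
  also have "\<dots> = m ^ card (surface_vertices T)"
    by (simp add: card_PiE finite_surface_vertices)
  finally show ?thesis .
qed

end

section \<open>Evaluation of the state sum\<close>

lemma sum_PiE_lessThan_3:
  fixes A :: "nat \<Rightarrow> 'a set"
  shows "(\<Sum>y \<in> Pi\<^sub>E {..<3} A. F (y 0) (y 1) (y 2)) = (\<Sum>p\<in>A 0. \<Sum>q\<in>A 1. \<Sum>r\<in>A 2. F p q r)"
proof -
  have less_3: "i < 3 \<longleftrightarrow> i = 0 \<or> i = 1 \<or> i = 2" for i :: nat by auto
  have "(\<Sum>p\<in>A 0. \<Sum>q\<in>A 1. \<Sum>r\<in>A 2. F p q r) = (\<Sum>(p, q, r) \<in> A 0 \<times> A 1 \<times> A 2. F p q r)"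
    by (simp add: sum.cartesian_product)
  also have "\<dots> = (\<Sum>y \<in> Pi\<^sub>E {..<3} A. F (y 0) (y 1) (y 2))"
    by (rule sum.reindex_bij_witness[where i = "\<lambda>y. (y 0, y 1, y 2)" and
          j = "\<lambda>(p, q, r). \<lambda>i\<in>{..<3}. if i = 0 then p else if i = 1 then q else r"])
      (auto simp: less_3 PiE_def extensional_def Pi_def fun_eq_iff)
  finally show ?thesis by simp
qed

locale split_state_sum = split_frobenius_algebra smul S \<epsilon> \<iota> J m \<psi> R + closed_surface T
  for smul :: "'k::field \<Rightarrow> 'a::{ring,monoid_mult} \<Rightarrow> 'a" and S \<epsilon>
    and \<iota> :: "'k \<Rightarrow> 'c::field" and J :: "'j set" and m \<psi> and R and T :: "'t triangulation" +
  assumes connected: "connected_triangulation T"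
begin

text \<open>
  Expanding the trace of a product of three matrices labels each triangle by a matrix block and
  each of its corners by a matrix index of that block.
\<close>

definition labels :: "('j \<times> (nat \<Rightarrow> nat)) set" where
  "labels = (SIGMA j:J. {..<3} \<rightarrow>\<^sub>E {..<m j})"

definition block :: "('t \<Rightarrow> 'j \<times> (nat \<Rightarrow> nat)) \<Rightarrow> 't \<times> nat \<Rightarrow> 'j" where
  "block x d = fst (x (fst d))"

definition corner :: "('t \<Rightarrow> 'j \<times> (nat \<Rightarrow> nat)) \<Rightarrow> 't \<times> nat \<Rightarrow> nat" where
  "corner x d = snd (x (fst d)) (snd d)"

text \<open>An edge runs from its own corner to the next one, so these two corners carry the row and
  the column index of its matrix.\<close>

definition entry :: "('t \<Rightarrow> 'j \<times> (nat \<Rightarrow> nat)) \<Rightarrow> 't \<times> nat \<Rightarrow> 'a \<Rightarrow> 'c" where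
  "entry x d a = \<psi> (block x d) a (corner x d) (corner x (next_edge d))"

text \<open>Exactly the labellings for which every edge contraction is nonzero. The corners match
  crosswise because glued edges run in opposite directions.\<close>

definition flat :: "('t \<Rightarrow> 'j \<times> (nat \<Rightarrow> nat)) \<Rightarrow> bool" where
  "flat x \<longleftrightarrow> (\<forall>d\<in>edge_sides. block x (glue T d) = block x d \<and>
     corner x (next_edge (glue T d)) = corner x d \<and> corner x (glue T d) = corner x (next_edge d))"

lemma finite_labels: "finite labels"
  unfolding labels_def using finite_index by (intro finite_SigmaI) (auto intro: finite_PiE)

lemma block_in: "x \<in> triangles T \<rightarrow>\<^sub>E labels \<Longrightarrow> d \<in> triangle_edges T \<Longrightarrow> block x d \<in> J"
  by (force simp: block_def labels_def triangle_edges_def PiE_def Pi_def)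

lemma corner_less:
  "x \<in> triangles T \<rightarrow>\<^sub>E labels \<Longrightarrow> d \<in> triangle_edges T \<Longrightarrow> corner x d < m (block x d)"
  by (force simp: block_def corner_def labels_def triangle_edges_def PiE_def Pi_def)

lemma block_next_edge [simp]: "block x (next_edge d) = block x d"
  by (simp add: block_def)

lemma triangle_amplitude_eq:
  "\<iota> (triangle_amplitude \<epsilon> s t) = (\<Sum>z\<in>labels. weight (fst z) *
     (\<Prod>i<3. \<psi> (fst z) (s (t, i)) (snd z i) (snd z ((i + 1) mod 3))))"
proof -
  have "\<iota> (triangle_amplitude \<epsilon> s t) = (\<Sum>j\<in>J. weight j * (\<Sum>p<m j. \<Sum>r<m j. \<Sum>q<m j.
      \<psi> j (s (t, 0)) p q * \<psi> j (s (t, 1)) q r * \<psi> j (s (t, 2)) r p))"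
    by (simp add: triangle_amplitude_def form_eq_trace rep_mult sum_distrib_right)
  also have "\<dots> = (\<Sum>j\<in>J. weight j * (\<Sum>y \<in> {..<3::nat} \<rightarrow>\<^sub>E {..<m j}.
      \<psi> j (s (t, 0)) (y 0) (y 1) * \<psi> j (s (t, 1)) (y 1) (y 2) * \<psi> j (s (t, 2)) (y 2) (y 0)))"
  \<comment> \<open>The left-associated product puts the sum over the middle index \<open>q\<close>
    innermost; a swap restores the cyclic order of the corners.\<close>
  proof (intro sum.cong refl arg_cong[where f = "(*) _"])
    fix j
    show "(\<Sum>p<m j. \<Sum>r<m j. \<Sum>q<m j.
        \<psi> j (s (t, 0)) p q * \<psi> j (s (t, 1)) q r * \<psi> j (s (t, 2)) r p) =
      (\<Sum>y \<in> {..<3::nat} \<rightarrow>\<^sub>E {..<m j}.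
        \<psi> j (s (t, 0)) (y 0) (y 1) * \<psi> j (s (t, 1)) (y 1) (y 2) * \<psi> j (s (t, 2)) (y 2) (y 0))"
      unfolding sum_PiE_lessThan_3[where A = "\<lambda>_. {..<m j}" and
          F = "\<lambda>p q r. \<psi> j (s (t, 0)) p q * \<psi> j (s (t, 1)) q r * \<psi> j (s (t, 2)) r p"]
      by (rule sum.cong[OF refl], rule sum.swap)
  qed
  also have "\<dots> = (\<Sum>j\<in>J. \<Sum>y \<in> {..<3::nat} \<rightarrow>\<^sub>E {..<m j}. weight j *
      (\<Prod>i<3. \<psi> j (s (t, i)) (y i) (y ((i + 1) mod 3))))"
  proof -
    have "(\<Prod>i<3. h i) = h 0 * h 1 * h 2" for h :: "nat \<Rightarrow> 'c"
      by (simp add: numeral_3_eq_3 numeral_2_eq_2 lessThan_Suc mult_ac)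
    then show ?thesis by (simp add: sum_distrib_left numeral_2_eq_2)
  qed
  also have "\<dots> = (\<Sum>z\<in>labels. weight (fst z) *
      (\<Prod>i<3. \<psi> (fst z) (s (t, i)) (snd z i) (snd z ((i + 1) mod 3))))"
    unfolding labels_def using finite_index
    by (subst sum.Sigma) (auto simp: case_prod_beta intro: finite_PiE)
  finally show ?thesis .
qed

lemma prod_triangle_amplitude:
  "\<iota> (\<Prod>t\<in>triangles T. triangle_amplitude \<epsilon> s t) = (\<Sum>x \<in> triangles T \<rightarrow>\<^sub>E labels.
     (\<Prod>t\<in>triangles T. weight (fst (x t))) *
     (\<Prod>d\<in>edge_sides. entry x d (s d) * entry x (glue T d) (s (glue T d))))"
proof -
  have "\<iota> (\<Prod>t\<in>triangles T. triangle_amplitude \<epsilon> s t) =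
      (\<Sum>x \<in> triangles T \<rightarrow>\<^sub>E labels. \<Prod>t\<in>triangles T. weight (fst (x t)) *
        (\<Prod>i<3. entry x (t, i) (s (t, i))))"
    unfolding emb.hom_prod triangle_amplitude_eq
    by (subst prod_sum_PiE)
      (simp_all add: finite_triangles finite_labels entry_def block_def corner_def next_edge_def)
  also have "\<dots> = (\<Sum>x \<in> triangles T \<rightarrow>\<^sub>E labels. (\<Prod>t\<in>triangles T. weight (fst (x t))) *
      (\<Prod>d\<in>triangle_edges T. entry x d (s d)))"
    by (simp add: prod.distrib prod.cartesian_product triangle_edges_def case_prod_beta)
  finally show ?thesis by (simp only: prod_triangle_edges)
qed

text \<open>Contracting the states of one edge gives an entry of the invariant tensor, whose support
  expresses the matching of blocks and corners across that edge.\<close>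

lemma sum_edge_states:
  assumes x: "x \<in> triangles T \<rightarrow>\<^sub>E labels" and d: "d \<in> edge_sides"
  shows "(\<Sum>a\<in>S. \<Sum>b\<in>S. \<iota> (form_inverse S \<epsilon> a b) * (entry x d a * entry x (glue T d) b)) =
    (if block x (glue T d) = block x d \<and> corner x (next_edge (glue T d)) = corner x d \<and>
       corner x (glue T d) = corner x (next_edge d) then 1 / weight (block x d) else 0)"
proof -
  have d': "d \<in> triangle_edges T"
    using d edge_sides_subset by blast
  note in_edges = d' next_edge_in_triangle_edges[OF d'] glue(1)[OF d']
    next_edge_in_triangle_edges[OF glue(1)[OF d']]
  have "(\<Sum>a\<in>S. \<Sum>b\<in>S. \<iota> (form_inverse S \<epsilon> a b) * (entry x d a * entry x (glue T d) b)) =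
      casimir (block x d) (corner x d) (corner x (next_edge d))
        (block x (glue T d)) (corner x (glue T d)) (corner x (next_edge (glue T d)))"
    by (simp add: casimir_def entry_def mult_ac)
  also have "\<dots> = (if block x (glue T d) = block x d \<and> corner x (next_edge (glue T d)) = corner x d \<and>
       corner x (glue T d) = corner x (next_edge d) then 1 / weight (block x d) else 0)"
    using in_edges[THEN block_in[OF x]] in_edges[THEN corner_less[OF x]]
    by (intro casimir_eq(1)) simp_all
  finally show ?thesis .
qed

text \<open>Once the sum over labellings is taken outside, the states of different edges decouple,
  and a single mismatched edge makes the whole product vanish.\<close>

lemma state_sum_eq_sum_flat:
  "\<iota> (state_sum R S \<epsilon> T) = \<iota> R ^ card (surface_vertices T) *
     (\<Sum>x \<in> {x \<in> triangles T \<rightarrow>\<^sub>E labels. flat x}.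
       (\<Prod>t\<in>triangles T. weight (fst (x t))) * (\<Prod>d\<in>edge_sides. 1 / weight (block x d)))"
proof -
  let ?W = "\<lambda>x. \<Prod>t\<in>triangles T. weight (fst (x t))"
  let ?B = "\<lambda>d a b. \<iota> (form_inverse S \<epsilon> a b)"
  have fin: "finite (triangles T \<rightarrow>\<^sub>E labels)"
    by (intro finite_PiE finite_triangles finite_labels)
  have "(\<Sum>s \<in> triangle_edges T \<rightarrow>\<^sub>E S.
      \<iota> ((\<Prod>t\<in>triangles T. triangle_amplitude \<epsilon> s t) *
        (\<Prod>e\<in>surface_edges T. edge_amplitude S \<epsilon> T s e))) =
    (\<Sum>s \<in> triangle_edges T \<rightarrow>\<^sub>E S. \<Sum>x \<in> triangles T \<rightarrow>\<^sub>E labels. ?W x *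
      (\<Prod>d\<in>edge_sides. \<iota> (form_inverse S \<epsilon> (s d) (s (glue T d))) *
        (entry x d (s d) * entry x (glue T d) (s (glue T d)))))"
    unfolding emb.hom_mult prod_triangle_amplitude prod_edge_amplitude sum_distrib_right
    by (simp add: emb.hom_prod prod.distrib mult_ac)
  also have "\<dots> = (\<Sum>x \<in> triangles T \<rightarrow>\<^sub>E labels. ?W x * (\<Sum>s \<in> triangle_edges T \<rightarrow>\<^sub>E S.
      \<Prod>d\<in>edge_sides. \<iota> (form_inverse S \<epsilon> (s d) (s (glue T d))) *
        (entry x d (s d) * entry x (glue T d) (s (glue T d)))))"
    by (subst sum.swap) (simp add: sum_distrib_left)
  also have "\<dots> = (\<Sum>x \<in> triangles T \<rightarrow>\<^sub>E labels. ?W x * (\<Prod>d\<in>edge_sides. \<Sum>a\<in>S. \<Sum>b\<in>S.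
      \<iota> (form_inverse S \<epsilon> a b) * (entry x d a * entry x (glue T d) b)))"
    by (subst sum_PiE_paired[OF finite_edge_sides finite_Basis inj_on_glue edge_sides_disjoint,
          unfolded edge_sides_cover, symmetric]) simp
  also have "\<dots> = (\<Sum>x \<in> triangles T \<rightarrow>\<^sub>E labels. if flat x
      then ?W x * (\<Prod>d\<in>edge_sides. 1 / weight (block x d)) else 0)"
  proof (rule sum.cong)
    fix x assume x: "x \<in> triangles T \<rightarrow>\<^sub>E labels"
    show "?W x * (\<Prod>d\<in>edge_sides. \<Sum>a\<in>S. \<Sum>b\<in>S.
        \<iota> (form_inverse S \<epsilon> a b) * (entry x d a * entry x (glue T d) b)) =
      (if flat x then ?W x * (\<Prod>d\<in>edge_sides. 1 / weight (block x d)) else 0)"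
    proof (cases "flat x")
      case True
      then show ?thesis
        by (simp add: sum_edge_states[OF x] flat_def cong: prod.cong)
    next
      case False
      then obtain d where d: "d \<in> edge_sides" and "\<not> (block x (glue T d) = block x d \<and>
          corner x (next_edge (glue T d)) = corner x d \<and> corner x (glue T d) = corner x (next_edge d))"
        unfolding flat_def by blast
      then have "(\<Sum>a\<in>S. \<Sum>b\<in>S.
          \<iota> (form_inverse S \<epsilon> a b) * (entry x d a * entry x (glue T d) b)) = 0"
        by (simp only: sum_edge_states[OF x d] if_False)
      then have "(\<Prod>d\<in>edge_sides. \<Sum>a\<in>S. \<Sum>b\<in>S.
          \<iota> (form_inverse S \<epsilon> a b) * (entry x d a * entry x (glue T d) b)) = 0"
        by (intro prod_zero finite_edge_sides bexI[OF _ d])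
      then show ?thesis using False by simp
    qed
  qed simp
  also have "\<dots> = (\<Sum>x \<in> {x \<in> triangles T \<rightarrow>\<^sub>E labels. flat x}.
      ?W x * (\<Prod>d\<in>edge_sides. 1 / weight (block x d)))"
    using fin by (simp add: sum.inter_filter)
  finally show ?thesis
    by (simp add: state_sum_def emb.hom_mult emb.hom_power emb.hom_sum)
qed

section \<open>Flat labellings of a connected surface\<close>

definition corner_labellings :: "'j \<Rightarrow> ('t \<times> nat \<Rightarrow> nat) set" where
  "corner_labellings j = {f \<in> triangle_edges T \<rightarrow>\<^sub>E {..<m j}.
     \<forall>d\<in>triangle_edges T. f d = f (next_edge (glue T d))}"

definition labelling :: "'j \<times> ('t \<times> nat \<Rightarrow> nat) \<Rightarrow> 't \<Rightarrow> 'j \<times> (nat \<Rightarrow> nat)" where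
  "labelling z = (\<lambda>t\<in>triangles T. (fst z, \<lambda>i\<in>{..<3}. snd z (t, i)))"

lemma block_labelling: "d \<in> triangle_edges T \<Longrightarrow> block (labelling z) d = fst z"
  by (auto simp: block_def labelling_def triangle_edges_def)

lemma corner_labelling: "d \<in> triangle_edges T \<Longrightarrow> corner (labelling z) d = snd z d"
  by (auto simp: corner_def labelling_def triangle_edges_def)

text \<open>Connectedness enters here: the block is constant on a triangle and passes through every
  gluing, so each flat labelling lives in one block.\<close>

lemma flat_block_constant:
  assumes "flat x" "d \<in> triangle_edges T" "d' \<in> triangle_edges T"
  shows "block x d = block x d'"
proof -
  have glue_eq: "block x (glue T d) = block x d" if d: "d \<in> triangle_edges T" for d
  proof -
    consider "d \<in> edge_sides" | e where "e \<in> edge_sides" "d = glue T e"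
      using d edge_sides_cover by blast
    then show ?thesis
      using assms(1) edge_sides_subset glue(3) by cases (auto simp: flat_def)
  qed
  have "equivclp (\<lambda>x y. x \<in> triangle_edges T \<and> (y = next_edge x \<or> y = glue T x)) d d'"
    using connected assms by (simp add: connected_triangulation_def)
  then show ?thesis
    by (induction rule: equivclp_induct) (use glue_eq in auto)
qed

text \<open>Flatness is imposed at one chosen side per edge. At the other side the condition follows
  from the second corner equation, because the gluing is an involution.\<close>

lemma flat_corner:
  assumes "flat x" "d \<in> triangle_edges T"
  shows "corner x (next_edge (glue T d)) = corner x d"
proof -
  consider "d \<in> edge_sides" | e where "e \<in> edge_sides" "d = glue T e"
    using assms(2) edge_sides_cover by blast
  then show ?thesis
  proof cases
    case 1
    then show ?thesis using assms(1) by (simp add: flat_def)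
  next
    case 2
    then have "e \<in> triangle_edges T" using edge_sides_subset by blast
    then show ?thesis using 2 assms(1) glue(3) by (simp add: flat_def)
  qed
qed

lemma bij_betw_labelling:
  "bij_betw labelling (SIGMA j:J. corner_labellings j) {x \<in> triangles T \<rightarrow>\<^sub>E labels. flat x}"
proof (rule bij_betw_imageI)
  \<comment> \<open>A base triangle is needed to read off the common block; without triangles a
    labelling would not determine it.\<close>
  obtain t0 where "t0 \<in> triangles T"
    using connected by (auto simp: connected_triangulation_def)
  then have "(t0, 0) \<in> triangle_edges T"
    by (simp add: triangle_edges_def)
  then obtain d0 where d0: "d0 \<in> triangle_edges T"
    by blast
  show "inj_on labelling (SIGMA j:J. corner_labellings j)"
  proof (rule inj_onI)
    fix z w assume z: "z \<in> (SIGMA j:J. corner_labellings j)" and w: "w \<in> (SIGMA j:J. corner_labellings j)"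
      and eq: "labelling z = labelling w"
    have "fst z = fst w"
      using block_labelling[OF d0] eq by metis
    moreover have "snd z = snd w"
    proof (rule extensionalityI[of _ "triangle_edges T"])
      show "snd z \<in> extensional (triangle_edges T)" "snd w \<in> extensional (triangle_edges T)"
        using z w by (auto simp: corner_labellings_def PiE_def)
      show "snd z d = snd w d" if "d \<in> triangle_edges T" for d
        using corner_labelling[OF that] eq by metis
    qed
    ultimately show "z = w" by (simp add: prod_eq_iff)
  qed
  show "labelling ` (SIGMA j:J. corner_labellings j) = {x \<in> triangles T \<rightarrow>\<^sub>E labels. flat x}"
  proof (intro equalityI subsetI)
    fix x assume "x \<in> labelling ` (SIGMA j:J. corner_labellings j)"
    then obtain z where x: "x = labelling z" and z: "fst z \<in> J" "snd z \<in> corner_labellings (fst z)"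
      by auto
    from z(2) have zP: "snd z \<in> triangle_edges T \<rightarrow>\<^sub>E {..<m (fst z)}"
      unfolding corner_labellings_def by blast
    then have "x \<in> triangles T \<rightarrow>\<^sub>E labels"
      using z(1) PiE_mem[OF zP] by (simp add: x labelling_def labels_def restrict_PiE_iff triangle_edges_def)
    moreover have "flat x"
      unfolding flat_def
    proof (intro ballI)
      fix d assume "d \<in> edge_sides"
      then have d: "d \<in> triangle_edges T" using edge_sides_subset by blast
      have inv: "snd z e = snd z (next_edge (glue T e))" if "e \<in> triangle_edges T" for e
        using z(2) that unfolding corner_labellings_def by blast
      show "block x (glue T d) = block x d \<and> corner x (next_edge (glue T d)) = corner x d \<and>
          corner x (glue T d) = corner x (next_edge d)"
        using inv[OF d] inv[OF glue(1)[OF d]] d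
        by (simp add: x block_labelling corner_labelling glue next_edge_in_triangle_edges)
    qed
    ultimately show "x \<in> {x \<in> triangles T \<rightarrow>\<^sub>E labels. flat x}" by simp
  next
    fix x assume "x \<in> {x \<in> triangles T \<rightarrow>\<^sub>E labels. flat x}"
    then have x: "x \<in> triangles T \<rightarrow>\<^sub>E labels" and "flat x" by auto
    define z where "z = (block x d0, \<lambda>d\<in>triangle_edges T. corner x d)"
    have const: "block x d = block x d0" if "d \<in> triangle_edges T" for d
      using flat_block_constant[OF \<open>flat x\<close> that d0] .
    have "fst z \<in> J"
      using block_in[OF x d0] by (simp add: z_def)
    moreover have "snd z \<in> corner_labellings (fst z)"
      using corner_less[OF x] const flat_corner[OF \<open>flat x\<close>]
      by (simp add: z_def corner_labellings_def glue(1) next_edge_in_triangle_edges)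
    moreover have "x = labelling z"
    proof (rule extensionalityI[of _ "triangles T"])
      show "x \<in> extensional (triangles T)" "labelling z \<in> extensional (triangles T)"
        using x by (auto simp: labelling_def PiE_def)
      fix t assume t: "t \<in> triangles T"
      then have "snd (x t) \<in> extensional {..<3}"
        using x by (force simp: labels_def PiE_def Pi_def)
      then have "snd (x t) = (\<lambda>i\<in>{..<3}. snd (x t) i)"
        by (auto simp: extensional_def)
      then show "x t = labelling z t"
        using t const[of "(t, 0)"]
        by (auto simp: labelling_def z_def prod_eq_iff block_def corner_def triangle_edges_def
            cong: restrict_cong)
    qed
    ultimately show "x \<in> labelling ` (SIGMA j:J. corner_labellings j)"
      by (intro image_eqI[of _ _ z]) (auto simp: mem_Sigma_iff prod.collapse intro!: SigmaI[of "fst z" _ "snd z", unfolded prod.collapse])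
  qed
qed

theorem state_sum_eq: "\<iota> (state_sum R S \<epsilon> T) = (\<Sum>j\<in>J. weight j powi euler_characteristic T)"
proof -
  let ?V = "card (surface_vertices T)" and ?E = "card (surface_edges T)" and ?F = "card (triangles T)"
  have fin: "finite (corner_labellings j)" for j
    unfolding corner_labellings_def
    by (rule finite_subset[of _ "triangle_edges T \<rightarrow>\<^sub>E {..<m j}"])
      (auto intro: finite_PiE finite_triangle_edges)
  have "(\<Sum>x \<in> {x \<in> triangles T \<rightarrow>\<^sub>E labels. flat x}.
      (\<Prod>t\<in>triangles T. weight (fst (x t))) * (\<Prod>d\<in>edge_sides. 1 / weight (block x d))) =
    (\<Sum>z \<in> (SIGMA j:J. corner_labellings j). (\<Prod>t\<in>triangles T. weight (fst (labelling z t))) *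
      (\<Prod>d\<in>edge_sides. 1 / weight (block (labelling z) d)))"
    by (rule sum.reindex_bij_betw[OF bij_betw_labelling, symmetric])
  also have "\<dots> = (\<Sum>z \<in> (SIGMA j:J. corner_labellings j). weight (fst z) ^ ?F * (1 / weight (fst z)) ^ ?E)"
  proof (rule sum.cong)
    fix z
    have "(\<Prod>d\<in>edge_sides. 1 / weight (block (labelling z) d)) = (\<Prod>d\<in>edge_sides. 1 / weight (fst z))"
      using edge_sides_subset by (intro prod.cong) (auto simp: block_labelling subset_iff)
    then show "(\<Prod>t\<in>triangles T. weight (fst (labelling z t))) *
        (\<Prod>d\<in>edge_sides. 1 / weight (block (labelling z) d)) =
      weight (fst z) ^ ?F * (1 / weight (fst z)) ^ ?E"
      by (simp add: labelling_def card_edge_sides)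
  qed simp
  also have "\<dots> = (\<Sum>j\<in>J. of_nat (m j) ^ ?V * (weight j ^ ?F * (1 / weight j) ^ ?E))"
  proof -
    have card: "card (corner_labellings j) = m j ^ ?V" for j
      unfolding corner_labellings_def by (rule card_corner_labellings)
    have "(\<Sum>z \<in> (SIGMA j:J. corner_labellings j). weight (fst z) ^ ?F * (1 / weight (fst z)) ^ ?E) =
        (\<Sum>j\<in>J. \<Sum>f\<in>corner_labellings j. weight j ^ ?F * (1 / weight j) ^ ?E)"
      using finite_index fin by (subst sum.Sigma) (simp_all add: case_prod_beta)
    then show ?thesis by (simp add: card)
  qed
  \<comment> \<open>The factor R^V of the state sum and the m_j^V corner labellings combine to the
    V-th power of the weight.\<close>
  finally have "\<iota> (state_sum R S \<epsilon> T) =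
      (\<Sum>j\<in>J. weight j ^ ?V * (weight j ^ ?F * (1 / weight j) ^ ?E))"
    by (simp add: state_sum_eq_sum_flat sum_distrib_left weight_def power_mult_distrib mult_ac)
  also have "\<dots> = (\<Sum>j\<in>J. weight j powi euler_characteristic T)"
  proof (rule sum.cong)
    fix j assume "j \<in> J"
    \<comment> \<open>The Euler characteristic may be negative, so splitting the integer power
      requires a nonzero base.\<close>
    then have "weight j \<noteq> 0"
      using casimir_eq(2)[of j 0 0 j 0 0] size_pos[of j] by simp
    then show "weight j ^ ?V * (weight j ^ ?F * (1 / weight j) ^ ?E) = weight j powi euler_characteristic T"
      unfolding euler_characteristic_def
      by (subst power_int_add, simp, subst power_int_diff, simp) (simp add: power_one_over)
  qed simp
  finally show ?thesis .
qed

end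

text \<open>The common source of both formulas: all blocks into which a summand splits have the same
  size, so they contribute a multiplicity \<open>card (K i)\<close>.\<close>

lemma state_sum_split:
  assumes T: "triangulates_genus T g"
    and frob: "symmetric_special_frobenius_algebra s S \<epsilon>"
    and R: "s R (distinguished_element s S \<epsilon>) = 1"
    and iso: "algebra_isomorphic s (direct_sum_algebra I M)"
    and I: "finite I" and hom: "field_hom \<iota>"
    and split: "\<And>i. i \<in> I \<Longrightarrow> \<exists>\<psi>. matrix_splitting \<iota> (M i) (K i) (\<lambda>_. m i) \<psi>"
  shows "\<iota> (state_sum R S \<epsilon> T) =
    \<iota> R powi (2 - 2 * int g) * (\<Sum>i\<in>I. of_nat (card (K i)) * of_nat (m i) powi (2 - 2 * int g))"
proof -
  obtain \<psi> where \<psi>: "\<And>i. i \<in> I \<Longrightarrow> matrix_splitting \<iota> (M i) (K i) (\<lambda>_. m i) (\<psi> i)"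
    using split by metis
  obtain \<psi>' where "matrix_splitting \<iota> (ring_algebra s) (SIGMA i:I. K i) (\<lambda>(i, j). m i) \<psi>'"
    using matrix_splitting_isomorphic[OF matrix_splitting_direct_sum[OF I hom \<psi>] iso] by blast
  then interpret split_state_sum s S \<epsilon> \<iota> "SIGMA i:I. K i" "\<lambda>(i, j). m i" \<psi>' R T
    using frob R T
    by (simp add: split_state_sum_def split_frobenius_algebra_def split_frobenius_algebra_axioms_def
        closed_surface_def split_state_sum_axioms_def triangulates_genus_def)
  have "finite (K i)" if "i \<in> I" for i
    using matrix_splitting.finite_index[OF \<psi>[OF that]] .
  then have "(\<Sum>z\<in>(SIGMA i:I. K i). (\<iota> R * of_nat (m (fst z))) powi (2 - 2 * int g)) =
      (\<Sum>i\<in>I. \<Sum>j\<in>K i. (\<iota> R * of_nat (m i)) powi (2 - 2 * int g))"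
    using I by (subst sum.Sigma) (simp_all add: case_prod_beta)
  moreover have "euler_characteristic T = 2 - 2 * int g"
    using T by (simp add: triangulates_genus_def)
  ultimately show ?thesis
    by (simp add: state_sum_eq weight_def case_prod_beta power_int_mult_distrib sum_distrib_left mult_ac)
qed

theorem theorem2p4:
  fixes T :: "'t triangulation" and g :: nat and N :: nat and n :: "nat \<Rightarrow> nat"
    and D :: "nat \<Rightarrow> real_division_algebra"
    and scale\<^sub>C :: "complex \<Rightarrow> 'a::{ring,monoid_mult} \<Rightarrow> 'a" and S\<^sub>C :: "'a set"
    and \<epsilon>\<^sub>C :: "'a \<Rightarrow> complex" and R\<^sub>C :: complex
    and scale\<^sub>R :: "real \<Rightarrow> 'b::{ring,monoid_mult} \<Rightarrow> 'b" and S\<^sub>R :: "'b set"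
    and \<epsilon>\<^sub>R :: "'b \<Rightarrow> real" and R\<^sub>R :: real
  assumes "triangulates_genus T g"
    and "\<And>i. i \<in> {1..N} \<Longrightarrow> n i \<ge> 1"
  shows
    "(symmetric_special_frobenius_algebra scale\<^sub>C S\<^sub>C \<epsilon>\<^sub>C \<and>
      R\<^sub>C \<noteq> 0 \<and> scale\<^sub>C R\<^sub>C (distinguished_element scale\<^sub>C S\<^sub>C \<epsilon>\<^sub>C) = 1 \<and>
      algebra_isomorphic scale\<^sub>C (direct_sum_algebra {1..N} (\<lambda>i. mat_algebra ((*) :: complex \<Rightarrow> _) (n i)))
      \<longrightarrow>
      state_sum R\<^sub>C S\<^sub>C \<epsilon>\<^sub>C T =
        R\<^sub>C powi (2 - 2 * int g) * (\<Sum>i=1..N. of_nat (n i) powi (2 - 2 * int g)))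
     \<and>
     (symmetric_special_frobenius_algebra scale\<^sub>R S\<^sub>R \<epsilon>\<^sub>R \<and>
      R\<^sub>R \<noteq> 0 \<and> scale\<^sub>R R\<^sub>R (distinguished_element scale\<^sub>R S\<^sub>R \<epsilon>\<^sub>R) = 1 \<and>
      algebra_isomorphic scale\<^sub>R (direct_sum_algebra {1..N} (\<lambda>i. real_block (D i) (n i)))
      \<longrightarrow>
      state_sum R\<^sub>R S\<^sub>R \<epsilon>\<^sub>R T =
        R\<^sub>R powi (2 - 2 * int g) *
        (\<Sum>i=1..N. surface_weight (D i) g * of_nat (n i) powi (2 - 2 * int g)))"
proof (intro conjI impI; elim conjE)
  have n: "0 < n i" if "i \<in> {1..N}" for i
    using assms(2)[OF that] by simp
  let ?\<chi> = "2 - 2 * int g"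
  {
    assume frob: "symmetric_special_frobenius_algebra scale\<^sub>C S\<^sub>C \<epsilon>\<^sub>C"
      and R: "scale\<^sub>C R\<^sub>C (distinguished_element scale\<^sub>C S\<^sub>C \<epsilon>\<^sub>C) = 1"
      and iso: "algebra_isomorphic scale\<^sub>C
        (direct_sum_algebra {1..N} (\<lambda>i. mat_algebra ((*) :: complex \<Rightarrow> _) (n i)))"
    have "field_hom (id :: complex \<Rightarrow> complex)"
      by unfold_locales simp_all
    moreover have "\<exists>\<psi>. matrix_splitting id (mat_algebra ((*) :: complex \<Rightarrow> _) (n i)) {False} (\<lambda>_. n i) \<psi>"
      if "i \<in> {1..N}" for i
      using matrix_splitting_mat_algebra[OF matrix_splitting_complex n[OF that]] by auto
    ultimately show "state_sum R\<^sub>C S\<^sub>C \<epsilon>\<^sub>C T = R\<^sub>C powi ?\<chi> * (\<Sum>i=1..N. of_nat (n i) powi ?\<chi>)"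
      using state_sum_split[OF assms(1) frob R iso, of id "\<lambda>_. {False}" n] by simp
  next
    assume frob: "symmetric_special_frobenius_algebra scale\<^sub>R S\<^sub>R \<epsilon>\<^sub>R"
      and R: "scale\<^sub>R R\<^sub>R (distinguished_element scale\<^sub>R S\<^sub>R \<epsilon>\<^sub>R) = 1"
      and iso: "algebra_isomorphic scale\<^sub>R (direct_sum_algebra {1..N} (\<lambda>i. real_block (D i) (n i)))"
    have "field_hom complex_of_real"
      by unfold_locales
    from state_sum_split[OF assms(1) frob R iso _ this matrix_splitting_real_block[OF n]]
    have "complex_of_real (state_sum R\<^sub>R S\<^sub>R \<epsilon>\<^sub>R T) = of_real R\<^sub>R powi ?\<chi> *
        (\<Sum>i=1..N. of_nat (card (block_index (D i))) * of_nat (block_size (D i) (n i)) powi ?\<chi>)"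
      by simp
    also have "\<dots> = of_real R\<^sub>R powi ?\<chi> *
        (\<Sum>i=1..N. of_real (surface_weight (D i) g * of_nat (n i) powi ?\<chi>))"
    \<comment> \<open>Two blocks give the factor 2 for \<complex>, and doubled size gives 2^(2-2g)
      for the quaternions.\<close>
    proof (intro arg_cong2[where f = "(*)"] sum.cong refl)
      fix i
      show "of_nat (card (block_index (D i))) * of_nat (block_size (D i) (n i)) powi ?\<chi> =
          complex_of_real (surface_weight (D i) g * of_nat (n i) powi ?\<chi>)"
        by (cases "D i") (simp_all add: block_index_def block_size_def surface_weight_def card_UNIV_bool
            power_int_mult_distrib)
    qed
    also have "\<dots> = complex_of_real
        (R\<^sub>R powi ?\<chi> * (\<Sum>i=1..N. surface_weight (D i) g * of_nat (n i) powi ?\<chi>))"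
      by simp
    \<comment> \<open>The identity descends to \<real> because the embedding into \<complex> is
      injective.\<close>
    finally show "state_sum R\<^sub>R S\<^sub>R \<epsilon>\<^sub>R T =
        R\<^sub>R powi ?\<chi> * (\<Sum>i=1..N. surface_weight (D i) g * of_nat (n i) powi ?\<chi>)"
      by (simp only: of_real_eq_iff)
  }
qed

end
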